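(* Let $k$ be a field of characteristic $p>0$, let $S=k[x_0,\ldots,x_{m-1}]$ with its standard grading, and let $I=(g_0,\ldots,g_{n-1})\subset S$ be a homogeneous ideal, where $g_0,\ldots,g_{n-1}$ is a fixed minimal homogeneous generating set of $I$, such that $R=S/I$ is a graded Artinian Gorenstein $k$-algebra of socle degree $s$. Let $\operatorname{vol}:R_s\to k$ be a $k$-linear isomorphism, and let $\nu\in R_s$ be the unique class with $\operatorname{vol}(\nu)=1$. Put $I^{[p]}=(g_0^p,\ldots,g_{n-1}^p)$, $\hat R=S/I^{[p]}$, $\hat s=ps+m(p-1)$, and let $\hat{\operatorname{vol}}:\hat R_{\hat s}\to k$ be the unique $k$-linear functional with $\hat{\operatorname{vol}}(x_0^{p-1}\cdots x_{m-1}^{p-1}\nu^p)=1$. Then there is a unique element $\varepsilon\in((I^{[p]}:I)/I^{[p]})_{\hat s-s}$ satisfying $\hat{\operatorname{vol}}(\varepsilon\nu)=1$. Moreover, for every homogeneous polynomial $w\in S_s$ of degree $s$, $$\operatorname{vol}(w)=\sum_{u\in M_s}\bigl((x_0^{p-1}\cdots x_{m-1}^{p-1}u^p)\circ(\varepsilon w)\bigr)\operatorname{vol}(u)^p .$$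
   Context: $M_c$ denotes the set of monic monomials of degree $c$ in $x_0,\ldots,x_{m-1}$. The Kronecker pairing $\circ:S\times S\to k$ is the $k$-bilinear map with $x^\alpha\circ x^\beta=1$ if $\alpha=\beta$ and $0$ otherwise (so $x^\alpha\circ f$ is the coefficient of $x^\alpha$ in $f$). The subscript $d$ denotes the degree-$d$ graded piece, and $(I^{[p]}:I)=\{f\in S: fI\subset I^{[p]}\}$. Natural projections are suppressed from notation. For $f\in S_s$, $\operatorname{vol}(f)$ means $\operatorname{vol}$ of the class of $f$ in $R_s$. The symbol $\nu^p$ means the class in $\hat R$ of $(\nu')^p$ for any lift $\nu'\in S_s$ of $\nu$ (independent of the lift), and $\varepsilon\nu$ means the class in $\hat R_{\hat s}$ of the product of any lifts of $\varepsilon$ and $\nu$ to $S$ (independent of the lifts). In the displayed identity $\varepsilon w$ means $\varepsilon' w\in S_{\hat s}$ for any homogeneous polynomial representative $\varepsilon'\in S_{\hat s-s}$ of $\varepsilon$. The algebra $\hat R$ is graded Artinian Gorenstein of socle degree $\hat s$, so $\hat R_{\hat s}$ is one-dimensional over $k$, and the class of $x_0^{p-1}\cdots x_{m-1}^{p-1}\nu^p$ is a nonzero element of it. *)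

theory Defs
  imports
    "HOL-Algebra.QuotRing"
    "HOL-Library.Poly_Mapping"
begin

type_synonym 'k mpoly = "(nat \<Rightarrow>\<^sub>0 nat) \<Rightarrow>\<^sub>0 'k"

text \<open>The ring \<open>k[x\<^sub>0, \<dots>, x\<^bsub>m-1\<^esub>]\<close>: a polynomial is a finitely supported function on exponent
  vectors, and only the variables with index below \<open>m\<close> may occur. All operations are those of the
  ambient type.\<close>

definition poly_ring :: "nat \<Rightarrow> ('k::field mpoly) ring" where
  "poly_ring m =
    \<lparr>carrier = {f. \<forall>\<alpha>\<in>Poly_Mapping.keys f. Poly_Mapping.keys \<alpha> \<subseteq> {..<m}},
     mult = (*), one = 1, zero = 0, add = (+)\<rparr>"

definition var :: "nat \<Rightarrow> 'k::field mpoly" where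
  "var i = Poly_Mapping.single (Poly_Mapping.single i 1) 1"

definition const :: "'k \<Rightarrow> 'k::field mpoly" where
  "const c = Poly_Mapping.single 0 c"

definition exp_deg :: "(nat \<Rightarrow>\<^sub>0 nat) \<Rightarrow> nat" where
  "exp_deg \<alpha> = (\<Sum>i\<in>Poly_Mapping.keys \<alpha>. Poly_Mapping.lookup \<alpha> i)"

definition hom_part :: "nat \<Rightarrow> nat \<Rightarrow> 'k::field mpoly set" where
  "hom_part m d = {f \<in> carrier (poly_ring m). \<forall>\<alpha>\<in>Poly_Mapping.keys f. exp_deg \<alpha> = d}"

definition monomials :: "nat \<Rightarrow> nat \<Rightarrow> 'k::field mpoly set" where
  "monomials m c = {Poly_Mapping.single \<alpha> 1 |\<alpha>. Poly_Mapping.keys \<alpha> \<subseteq> {..<m} \<and> exp_deg \<alpha> = c}"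

definition kron_pairing :: "'k::field mpoly \<Rightarrow> 'k mpoly \<Rightarrow> 'k" where
  "kron_pairing f h = (\<Sum>\<alpha>\<in>Poly_Mapping.keys f. Poly_Mapping.lookup f \<alpha> * Poly_Mapping.lookup h \<alpha>)"

definition minimal_hom_gens :: "nat \<Rightarrow> nat \<Rightarrow> (nat \<Rightarrow> 'k::field mpoly) \<Rightarrow> 'k mpoly set \<Rightarrow> bool" where
  "minimal_hom_gens m n g I \<longleftrightarrow>
    (\<forall>i<n. \<exists>d. g i \<in> hom_part m d) \<and>
    I = genideal (poly_ring m) (g ` {..<n}) \<and>
    (\<forall>i<n. genideal (poly_ring m) (g ` ({..<n} - {i})) \<noteq> I)"

definition cls :: "nat \<Rightarrow> 'k::field mpoly set \<Rightarrow> 'k mpoly \<Rightarrow> 'k mpoly set" where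
  "cls m I f = I +>\<^bsub>poly_ring m\<^esub> f"

definition graded_piece :: "nat \<Rightarrow> 'k::field mpoly set \<Rightarrow> nat \<Rightarrow> 'k mpoly set set" where
  "graded_piece m I d = cls m I ` hom_part m d"

definition artinian :: "('a, 'b) ring_scheme \<Rightarrow> bool" where
  "artinian R \<longleftrightarrow> ring R \<and>
    (\<forall>J :: nat \<Rightarrow> 'a set. (\<forall>i. ideal (J i) R \<and> J (Suc i) \<subseteq> J i) \<longrightarrow> (\<exists>N. \<forall>i\<ge>N. J i = J N))"

text \<open>The socle of \<open>R = S/I\<close> is the annihilator of the graded maximal ideal, i.e. of the classes of
  the variables.\<close>

definition socle :: "nat \<Rightarrow> 'k::field mpoly set \<Rightarrow> 'k mpoly set set" where
  "socle m I = {r \<in> carrier (poly_ring m Quot I).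
    \<forall>i<m. cls m I (var i) \<otimes>\<^bsub>poly_ring m Quot I\<^esub> r = \<zero>\<^bsub>poly_ring m Quot I\<^esub>}"

text \<open>For a homogeneous ideal \<open>I\<close>: \<open>S/I\<close> is Artinian and its socle is one-dimensional over \<open>k\<close>
  and sits in degree \<open>s\<close>.\<close>

definition artinian_gorenstein :: "nat \<Rightarrow> 'k::field mpoly set \<Rightarrow> nat \<Rightarrow> bool" where
  "artinian_gorenstein m I s \<longleftrightarrow>
    artinian (poly_ring m Quot I) \<and>
    (\<exists>r \<in> carrier (poly_ring m Quot I). r \<noteq> \<zero>\<^bsub>poly_ring m Quot I\<^esub> \<and>
      socle m I = {cls m I (const c) \<otimes>\<^bsub>poly_ring m Quot I\<^esub> r |c. True}) \<and>
    socle m I \<subseteq> graded_piece m I s"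

text \<open>A \<open>k\<close>-linear functional on \<open>(S/I)\<^sub>d\<close>; the function is unconstrained elsewhere.\<close>

definition linear_functional :: "nat \<Rightarrow> 'k::field mpoly set \<Rightarrow> nat \<Rightarrow> ('k mpoly set \<Rightarrow> 'k) \<Rightarrow> bool" where
  "linear_functional m I d \<phi> \<longleftrightarrow>
    (\<forall>a\<in>graded_piece m I d. \<forall>b\<in>graded_piece m I d.
      \<phi> (a \<oplus>\<^bsub>poly_ring m Quot I\<^esub> b) = \<phi> a + \<phi> b) \<and>
    (\<forall>c. \<forall>a\<in>graded_piece m I d. \<phi> (cls m I (const c) \<otimes>\<^bsub>poly_ring m Quot I\<^esub> a) = c * \<phi> a)"

definition colon :: "nat \<Rightarrow> 'k::field mpoly set \<Rightarrow> 'k mpoly set \<Rightarrow> 'k mpoly set" where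
  "colon m J I = {f \<in> carrier (poly_ring m). \<forall>h\<in>I. f * h \<in> J}"

text \<open>The degree \<open>d\<close> piece of the ideal \<open>(J : I)/J\<close> of \<open>S/J\<close>.\<close>

definition colon_quot_piece :: "nat \<Rightarrow> 'k::field mpoly set \<Rightarrow> 'k mpoly set \<Rightarrow> nat \<Rightarrow> 'k mpoly set set" where
  "colon_quot_piece m J I d = cls m J ` colon m J I \<inter> graded_piece m J d"

text \<open>Operations on cosets that use lifts are written, as in \<^const>\<open>rcoset_mult\<close>, as unions over all
  lifts; these are unions of one and the same coset when the result does not depend on the lift.
  \<open>frob_cls m J p a\<close> is the class modulo \<open>J\<close> of \<open>f ^ p\<close> for \<open>f \<in> a\<close>, and \<open>lift_mult m J a b\<close> is the
  class modulo \<open>J\<close> of \<open>f * h\<close> for \<open>f \<in> a\<close> and \<open>h \<in> b\<close>, where \<open>b\<close> may be a coset of another ideal.\<close>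

definition frob_cls :: "nat \<Rightarrow> 'k::field mpoly set \<Rightarrow> nat \<Rightarrow> 'k mpoly set \<Rightarrow> 'k mpoly set" where
  "frob_cls m J p a = (\<Union>f\<in>a. cls m J (f ^ p))"

definition lift_mult :: "nat \<Rightarrow> 'k::field mpoly set \<Rightarrow> 'k mpoly set \<Rightarrow> 'k mpoly set \<Rightarrow> 'k mpoly set" where
  "lift_mult m J a b = rcoset_mult (poly_ring m) J a b"

lemma in_poly_ring_iff:
  "f \<in> carrier (poly_ring m) \<longleftrightarrow> (\<forall>\<alpha>\<in>Poly_Mapping.keys f. Poly_Mapping.keys \<alpha> \<subseteq> {..<m})"
  by (simp add: poly_ring_def)

lemma poly_ring_simps [simp]:
  "f \<otimes>\<^bsub>poly_ring m\<^esub> h = f * h" "f \<oplus>\<^bsub>poly_ring m\<^esub> h = f + h"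
  "\<one>\<^bsub>poly_ring m\<^esub> = 1" "\<zero>\<^bsub>poly_ring m\<^esub> = 0"
  by (simp_all add: poly_ring_def)

lemma poly_ring_mult_closed:
  assumes "f \<in> carrier (poly_ring m)" "h \<in> carrier (poly_ring m)"
  shows "f * h \<in> carrier (poly_ring m)"
  unfolding in_poly_ring_iff
proof
  fix \<alpha> assume a: "\<alpha> \<in> Poly_Mapping.keys (f * h)"
  obtain a b where ab: "\<alpha> = a + b" "a \<in> Poly_Mapping.keys f" "b \<in> Poly_Mapping.keys h"
    using keys_mult[of f h] a by blast
  have "Poly_Mapping.keys a \<union> Poly_Mapping.keys b \<subseteq> {..<m}"
    using assms ab unfolding in_poly_ring_iff by blast
  then show "Poly_Mapping.keys \<alpha> \<subseteq> {..<m}" using Poly_Mapping.keys_add[of a b] ab(1) by blast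
qed

lemma poly_ring_add_closed:
  assumes "f \<in> carrier (poly_ring m)" "h \<in> carrier (poly_ring m)"
  shows "f + h \<in> carrier (poly_ring m)"
  using assms Poly_Mapping.keys_add[of f h] unfolding in_poly_ring_iff by blast

lemma cring_poly_ring: "cring (poly_ring m :: ('k::field mpoly) ring)"
proof (rule cringI)
  show "abelian_group (poly_ring m :: ('k mpoly) ring)"
  proof (rule abelian_groupI)
    fix f :: "'k mpoly" assume f: "f \<in> carrier (poly_ring m)"
    have "- f \<in> carrier (poly_ring m)" using f unfolding in_poly_ring_iff by simp
    then show "\<exists>y\<in>carrier (poly_ring m). y \<oplus>\<^bsub>poly_ring m\<^esub> f = \<zero>\<^bsub>poly_ring m\<^esub>"
      by (rule rev_bexI) simp
  qed (simp_all add: poly_ring_add_closed in_poly_ring_iff[of 0] add.assoc add.commute)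
  show "Group.comm_monoid (poly_ring m :: ('k mpoly) ring)"
    by (rule comm_monoidI)
      (simp_all add: poly_ring_mult_closed in_poly_ring_iff[of 1] mult.assoc mult.commute)
qed (simp add: distrib_right)

end

theory Submission
  imports Complex_Main Defs "HOL-Computational_Algebra.Primes"
begin

text \<open>
  Write \<open>S = k[x\<^sub>0, \<dots>, x\<^bsub>m-1\<^esub>]\<close>, \<open>q = (p-1, \<dots>, p-1)\<close>, and let \<open>\<Lambda>\<close> be the functional on \<open>S\<close> that is \<open>vol\<close> in
  degree \<open>s\<close> and zero in all other degrees. Since \<open>S/I\<close> is Gorenstein, \<open>I\<close> is the annihilator of
  \<open>\<Lambda>\<close>: a polynomial \<open>f\<close> lies in \<open>I\<close> if and only if \<open>\<Lambda>(f h) = 0\<close> for all \<open>h\<close>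
  (\<open>volume_functional_nondegenerate\<close>).

  The same description of \<open>I\<^bsup>[p]\<^esup>\<close> is obtained from an explicit functional, namely
  \<open>\<Lambda>'(f) = \<Sum>\<^sub>\<alpha> f\<^bsub>p\<alpha>+q\<^esub> \<Lambda>(x\<^sup>\<alpha>)\<^sup>p\<close>, where \<open>f\<^sub>\<beta>\<close> denotes a coefficient of \<open>f\<close>. The reason is
  that \<open>S\<close> is free over its subring of \<open>p\<close>-th powers, with basis \<open>b x\<^sup>\<beta>\<close>, where \<open>b\<close> runs through a
  basis of \<open>k\<close> over \<open>k\<^sup>p\<close> and the exponents in \<open>\<beta>\<close> are less than \<open>p\<close>. Up to taking \<open>p\<close>-th roots,
  the coordinates of \<open>f\<close> are the polynomials \<open>cartier \<beta> b f\<close>. They are linear over \<open>p\<close>-th powers, and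
  the \<open>b\<close>-coordinate of \<open>\<Lambda>'(f)\<close> is \<open>\<Lambda>(cartier q b f)\<close>. Hence \<open>\<Lambda>'\<close> kills \<open>I\<^bsup>[p]\<^esup>\<close>
  (\<open>frobenius_functional_power_mult_eq_0\<close>). Conversely, if \<open>\<Lambda>'\<close> kills all multiples of \<open>f\<close>, then \<open>\<Lambda>\<close>
  kills all multiples of every coordinate of \<open>f\<close>, so the coordinates are in \<open>I\<close> and \<open>f \<in> I\<^bsup>[p]\<^esup>\<close>
  (\<open>mem_frobenius_power\<close>). In degree \<open>ps + m(p-1)\<close>, the only one in which \<open>\<Lambda>'\<close> can be nonzero,
  \<open>I\<^bsup>[p]\<^esup>\<close> is therefore the kernel of \<open>\<Lambda>'\<close>, and as \<open>\<Lambda>'(x\<^sup>q \<nu>\<^sup>p) = \<Lambda>(\<nu>)\<^sup>p = 1\<close>, the functional \<open>vol_hat\<close>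
  is \<open>\<Lambda>'\<close>.

  Now \<open>\<Lambda>\<close> vanishes on \<open>I \<supseteq> I\<^bsup>[p]\<^esup>\<close>, so by duality in the finite-dimensional space of polynomials of
  degree \<open>s\<close> it has the form \<open>w \<mapsto> \<Lambda>'(\<epsilon> w)\<close> (\<open>representing_element_exists\<close>), and such an \<open>\<epsilon>\<close>
  carries \<open>I\<close> into \<open>I\<^bsup>[p]\<^esup>\<close>. Conversely, an \<open>\<epsilon>\<close> that carries \<open>I\<close> into \<open>I\<^bsup>[p]\<^esup>\<close> and satisfies
  \<open>\<Lambda>'(\<epsilon> \<nu>) = 1\<close> represents \<open>\<Lambda>\<close>, because every \<open>w\<close> of degree \<open>s\<close> is congruent to \<open>\<Lambda>(w) \<nu>\<close> modulo \<open>I\<close>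
  (\<open>functional_from_colon\<close>). Since \<open>\<Lambda>'\<close> is nondegenerate on \<open>S/I\<^bsup>[p]\<^esup>\<close>, this makes \<open>\<epsilon>\<close> unique. The
  volume formula is the equation \<open>\<Lambda>(w) = \<Lambda>'(\<epsilon> w)\<close> with \<open>\<Lambda>'\<close> written out.
\<close>

section \<open>Polynomials, monomials and exponent vectors\<close>

abbreviation lookup :: "('a \<Rightarrow>\<^sub>0 'b::zero) \<Rightarrow> 'a \<Rightarrow> 'b" where
  "lookup \<equiv> Poly_Mapping.lookup"

abbreviation keys :: "('a \<Rightarrow>\<^sub>0 'b::zero) \<Rightarrow> 'a set" where
  "keys \<equiv> Poly_Mapping.keys"

abbreviation monom :: "(nat \<Rightarrow>\<^sub>0 nat) \<Rightarrow> 'k::zero \<Rightarrow> 'k mpoly" where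
  "monom \<equiv> Poly_Mapping.single"

lemma poly_mapping_sum_monomials: "(\<Sum>\<alpha>\<in>keys f. Poly_Mapping.single \<alpha> (lookup f \<alpha>)) = f"
proof (rule poly_mapping_eqI)
  fix k
  show "lookup (\<Sum>\<alpha>\<in>keys f. Poly_Mapping.single \<alpha> (lookup f \<alpha>)) k = lookup f k"
    by (cases "k \<in> keys f")
      (auto simp: lookup_sum lookup_single when_def not_in_keys_iff_lookup_eq_zero)
qed

lemma lookup_single_times_add:
  fixes \<gamma> \<delta> :: "'a::cancel_comm_monoid_add" and f :: "'a \<Rightarrow>\<^sub>0 'b::comm_semiring_1"
  shows "lookup (Poly_Mapping.single \<gamma> c * f) (\<gamma> + \<delta>) = c * lookup f \<delta>"
  by (simp add: lookup_mult lookup_single when_mult)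

lemma lookup_single_times_eq_0:
  fixes \<gamma> :: "'a::cancel_comm_monoid_add" and f :: "'a \<Rightarrow>\<^sub>0 'b::comm_semiring_1"
  assumes "\<And>\<delta>. \<alpha> \<noteq> \<gamma> + \<delta>"
  shows "lookup (Poly_Mapping.single \<gamma> c * f) \<alpha> = 0"
  using assms by (simp add: lookup_mult lookup_single when_mult)

lemma lookup_const_times: "lookup (const c * f) \<alpha> = c * lookup f \<alpha>"
  using lookup_single_times_add[of 0 c f \<alpha>] by (simp add: const_def)

text \<open>The exponent vector of \<open>(x\<^sup>\<alpha>)\<^sup>p\<close>.\<close>

definition scale_exp :: "nat \<Rightarrow> (nat \<Rightarrow>\<^sub>0 nat) \<Rightarrow> (nat \<Rightarrow>\<^sub>0 nat)" where
  "scale_exp p \<alpha> = Poly_Mapping.map ((*) p) \<alpha>"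

lemma lookup_scale_exp [simp]: "lookup (scale_exp p \<alpha>) i = p * lookup \<alpha> i"
  by (simp add: scale_exp_def Poly_Mapping.map.rep_eq when_def)

lemma scale_exp_add: "scale_exp p (\<alpha> + \<beta>) = scale_exp p \<alpha> + scale_exp p \<beta>"
  by (rule poly_mapping_eqI) (simp add: lookup_add distrib_left)

lemma inj_scale_exp_add: "p > 0 \<Longrightarrow> inj (\<lambda>\<alpha>. scale_exp p \<alpha> + \<beta>)"
proof (rule injI)
  fix \<alpha> \<gamma>
  assume "p > 0" and eq: "scale_exp p \<alpha> + \<beta> = scale_exp p \<gamma> + \<beta>"
  have "p * lookup \<alpha> i = p * lookup \<gamma> i" for i
    using arg_cong[OF eq, of "\<lambda>\<delta>. lookup \<delta> i"] by (simp add: lookup_add)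
  then show "\<alpha> = \<gamma>" using \<open>p > 0\<close> by (intro poly_mapping_eqI) simp
qed

lemma keys_exp_add: "keys (\<alpha> + \<beta> :: nat \<Rightarrow>\<^sub>0 nat) = keys \<alpha> \<union> keys \<beta>"
  by (auto simp: in_keys_iff lookup_add)

lemma keys_scale_exp: "p > 0 \<Longrightarrow> keys (scale_exp p \<alpha>) = keys \<alpha>"
  by (auto simp: in_keys_iff)

lemma exp_deg_superset:
  assumes "finite A" "keys \<alpha> \<subseteq> A"
  shows "exp_deg \<alpha> = (\<Sum>i\<in>A. lookup \<alpha> i)"
  unfolding exp_deg_def
  by (rule sum.mono_neutral_left) (use assms in \<open>auto simp: in_keys_iff\<close>)

lemma exp_deg_add: "exp_deg (\<alpha> + \<beta>) = exp_deg \<alpha> + exp_deg \<beta>"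
  using exp_deg_superset[of "keys \<alpha> \<union> keys \<beta>"]
  by (simp add: keys_exp_add lookup_add sum.distrib)

lemma exp_deg_scale: "exp_deg (scale_exp p \<alpha>) = p * exp_deg \<alpha>"
proof -
  have "exp_deg (scale_exp p \<alpha>) = (\<Sum>i\<in>keys \<alpha>. lookup (scale_exp p \<alpha>) i)"
    by (rule exp_deg_superset) (auto simp: in_keys_iff)
  then show ?thesis by (simp add: exp_deg_def sum_distrib_left)
qed

lemma single_power: "monom \<alpha> c ^ n = monom (scale_exp n \<alpha>) (c ^ n)" for c :: "'k::field"
proof (induction n)
  case 0
  have "scale_exp 0 \<alpha> = 0" by (rule poly_mapping_eqI) simp
  then show ?case by simp
next
  case (Suc n)
  have "scale_exp (Suc n) \<alpha> = \<alpha> + scale_exp n \<alpha>" by (rule poly_mapping_eqI) (simp add: lookup_add)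
  then show ?case by (simp add: Suc mult_single)
qed

definition exps :: "nat \<Rightarrow> nat \<Rightarrow> (nat \<Rightarrow>\<^sub>0 nat) set" where
  "exps m d = {\<alpha>. keys \<alpha> \<subseteq> {..<m} \<and> exp_deg \<alpha> = d}"

lemma finite_bounded_exponents:
  "finite {\<alpha> :: nat \<Rightarrow>\<^sub>0 nat. keys \<alpha> \<subseteq> {..<m} \<and> (\<forall>i. lookup \<alpha> i \<le> d)}" (is "finite ?A")
proof (rule finite_imageD)
  show "inj_on lookup ?A" by (rule inj_onI) simp
  show "finite (lookup ` ?A)"
    by (rule finite_subset[OF _ finite_set_of_finite_funs[of "{..<m}" "{..d}" 0]])
      (auto simp: in_keys_iff subset_iff)
qed

lemma finite_exps: "finite (exps m d)"
proof (rule finite_subset[OF _ finite_bounded_exponents])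
  have "lookup \<alpha> i \<le> exp_deg \<alpha>" for \<alpha> i
  proof -
    have "exp_deg \<alpha> = (\<Sum>j\<in>insert i (keys \<alpha>). lookup \<alpha> j)"
      by (rule exp_deg_superset) auto
    then show ?thesis by (simp add: member_le_sum)
  qed
  then show "exps m d \<subseteq> {\<alpha>. keys \<alpha> \<subseteq> {..<m} \<and> (\<forall>i. lookup \<alpha> i \<le> d)}"
    by (auto simp: exps_def)
qed

definition top_exp :: "nat \<Rightarrow> nat \<Rightarrow> (nat \<Rightarrow>\<^sub>0 nat)" where
  "top_exp m p = (\<Sum>i<m. Poly_Mapping.single i (p - 1))"

lemma lookup_top_exp: "lookup (top_exp m p) i = (if i < m then p - 1 else 0)"
  by (simp add: top_exp_def lookup_sum lookup_single when_def)

lemma keys_top_exp: "keys (top_exp m p) \<subseteq> {..<m}"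
  by (auto simp: in_keys_iff lookup_top_exp split: if_splits)

lemma exp_deg_top_exp: "exp_deg (top_exp m p) = m * (p - 1)"
  using exp_deg_superset[OF _ keys_top_exp, of m] by (simp add: lookup_top_exp)

lemma prod_var_power: "(\<Prod>i<m. var i ^ (p - 1)) = (monom (top_exp m p) 1 :: 'k::field mpoly)"
proof (induction m)
  case 0
  then show ?case by (simp add: top_exp_def)
next
  case (Suc m)
  have "scale_exp (p - 1) (Poly_Mapping.single m 1) = Poly_Mapping.single m (p - 1)"
    by (rule poly_mapping_eqI) (simp add: lookup_single when_def)
  then show ?case
    using Suc by (simp add: top_exp_def var_def single_power mult_single)
qed

lemma poly_ring_0: "0 \<in> carrier (poly_ring m)"
  by (simp add: in_poly_ring_iff)

lemma poly_ring_monom: "keys \<alpha> \<subseteq> {..<m} \<Longrightarrow> monom \<alpha> c \<in> carrier (poly_ring m)" for c :: "'k::field"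
  by (simp add: in_poly_ring_iff)

lemma poly_ring_const: "const c \<in> carrier (poly_ring m)"
  by (simp add: in_poly_ring_iff const_def)

lemma poly_ring_power: "f \<in> carrier (poly_ring m) \<Longrightarrow> f ^ n \<in> carrier (poly_ring m)"
  by (induction n) (simp_all add: poly_ring_mult_closed in_poly_ring_iff[of 1])

lemma hom_part_lookup:
  "f \<in> hom_part m d \<longleftrightarrow> (\<forall>\<alpha>. lookup f \<alpha> \<noteq> 0 \<longrightarrow> \<alpha> \<in> exps m d)"
  by (auto simp: hom_part_def in_poly_ring_iff exps_def in_keys_iff)

lemma hom_part_carrier: "f \<in> hom_part m d \<Longrightarrow> f \<in> carrier (poly_ring m)"
  by (simp add: hom_part_def)

lemma hom_part_mult:
  assumes "f \<in> hom_part m d" "h \<in> hom_part m e"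
  shows "f * h \<in> hom_part m (d + e)"
  using assms keys_mult[of f h] poly_ring_mult_closed[of f m h]
  by (fastforce simp: hom_part_def exp_deg_add)

lemma hom_part_0: "0 \<in> hom_part m d"
  by (simp add: hom_part_lookup)

lemma hom_part_add: "f \<in> hom_part m d \<Longrightarrow> h \<in> hom_part m d \<Longrightarrow> f + h \<in> hom_part m d"
  by (auto simp: hom_part_lookup lookup_add) (metis add.right_neutral)

lemma hom_part_minus: "f \<in> hom_part m d \<Longrightarrow> h \<in> hom_part m d \<Longrightarrow> f - h \<in> hom_part m d"
  by (auto simp: hom_part_lookup lookup_minus) (metis diff_zero)

lemma hom_part_const_mult: "f \<in> hom_part m d \<Longrightarrow> const c * f \<in> hom_part m d"
  by (auto simp: hom_part_lookup lookup_const_times)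

lemma hom_part_monom: "\<alpha> \<in> exps m d \<Longrightarrow> monom \<alpha> c \<in> hom_part m d" for c :: "'k::field"
  by (auto simp: hom_part_lookup lookup_single when_def)

lemma hom_part_sum:
  "(\<And>x. x \<in> A \<Longrightarrow> f x \<in> hom_part m d) \<Longrightarrow> sum f A \<in> hom_part m d"
  by (induction A rule: infinite_finite_induct) (simp_all add: hom_part_0 hom_part_add)

lemma hom_part_power: "f \<in> hom_part m d \<Longrightarrow> f ^ n \<in> hom_part m (n * d)"
proof (induction n)
  case 0
  then show ?case by (auto simp: hom_part_lookup lookup_one when_def exps_def exp_deg_def)
next
  case (Suc n)
  then show ?case using hom_part_mult[of f m d "f ^ n" "n * d"] by simp
qed

lemma hom_part_sum_monomials:
  assumes "f \<in> hom_part m d"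
  shows "f = (\<Sum>\<alpha>\<in>exps m d. monom \<alpha> (lookup f \<alpha>))"
proof -
  have "(\<Sum>\<alpha>\<in>keys f. monom \<alpha> (lookup f \<alpha>)) = (\<Sum>\<alpha>\<in>exps m d. monom \<alpha> (lookup f \<alpha>))"
    by (rule sum.mono_neutral_left)
      (use assms in \<open>auto simp: finite_exps hom_part_lookup in_keys_iff\<close>)
  then show ?thesis by (simp add: poly_mapping_sum_monomials)
qed

definition hom_comp :: "nat \<Rightarrow> 'k::field mpoly \<Rightarrow> 'k mpoly" where
  "hom_comp d f = Poly_Mapping.mapp (\<lambda>\<alpha> c. c when exp_deg \<alpha> = d) f"

lemma lookup_hom_comp: "lookup (hom_comp d f) \<alpha> = (if exp_deg \<alpha> = d then lookup f \<alpha> else 0)"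
  by (auto simp: hom_comp_def lookup_mapp when_def in_keys_iff)

lemma hom_comp_add: "hom_comp d (f + h) = hom_comp d f + hom_comp d h"
  by (rule poly_mapping_eqI) (simp add: lookup_hom_comp lookup_add)

lemma hom_comp_0: "hom_comp d 0 = 0"
  by (rule poly_mapping_eqI) (simp add: lookup_hom_comp)

lemma hom_comp_sum: "hom_comp d (sum f A) = (\<Sum>x\<in>A. hom_comp d (f x))"
  by (induction A rule: infinite_finite_induct) (simp_all add: hom_comp_0 hom_comp_add)

lemma hom_comp_hom_part: "f \<in> carrier (poly_ring m) \<Longrightarrow> hom_comp d f \<in> hom_part m d"
  by (auto simp: hom_part_lookup lookup_hom_comp in_poly_ring_iff exps_def in_keys_iff)

lemma hom_comp_homogeneous:
  "f \<in> hom_part m e \<Longrightarrow> hom_comp d f = (if d = e then f else 0)"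
  by (rule poly_mapping_eqI) (auto simp: lookup_hom_comp hom_part_lookup exps_def)

lemma hom_comp_monom_mult:
  "hom_comp d (monom \<gamma> c * f) =
    (if exp_deg \<gamma> \<le> d then monom \<gamma> c * hom_comp (d - exp_deg \<gamma>) f else 0)" for c :: "'k::field"
proof (rule poly_mapping_eqI)
  fix \<alpha>
  show "lookup (hom_comp d (monom \<gamma> c * f)) \<alpha> = lookup
    (if exp_deg \<gamma> \<le> d then monom \<gamma> c * hom_comp (d - exp_deg \<gamma>) f else 0) \<alpha>"
  proof (cases "\<exists>\<delta>. \<alpha> = \<gamma> + \<delta>")
    case True
    then obtain \<delta> where "\<alpha> = \<gamma> + \<delta>" by blast
    then show ?thesis
      by (auto simp: lookup_hom_comp lookup_single_times_add exp_deg_add)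
  next
    case False
    then show ?thesis by (simp add: lookup_hom_comp lookup_single_times_eq_0)
  qed
qed

section \<open>Ideals of the polynomial ring and their cosets\<close>

lemma ideal_poly_ringI:
  assumes "J \<subseteq> carrier (poly_ring m)" "0 \<in> J"
    and "\<And>f h. f \<in> J \<Longrightarrow> h \<in> J \<Longrightarrow> f + h \<in> J"
    and mult: "\<And>f h. f \<in> J \<Longrightarrow> h \<in> carrier (poly_ring m) \<Longrightarrow> h * f \<in> J"
  shows "ideal J (poly_ring m :: 'k::field mpoly ring)"
proof (rule idealI)
  interpret cring "poly_ring m :: 'k mpoly ring" by (rule cring_poly_ring)
  show "ring (poly_ring m :: 'k mpoly ring)" by unfold_locales
  have neg: "- f \<in> J" if "f \<in> J" for f
    using mult[OF that poly_ring_const[of "- 1"]] by (simp add: const_def single_uminus)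
  have "\<ominus>\<^bsub>poly_ring m\<^esub> f \<in> J" if f: "f \<in> J" for f
  proof -
    have "\<ominus>\<^bsub>poly_ring m\<^esub> f = - f"
      by (rule minus_equality) (use f neg[OF f] assms(1) in auto)
    then show ?thesis using neg[OF f] by simp
  qed
  then show "subgroup J (add_monoid (poly_ring m))"
    using assms(1-3) by (intro add.subgroupI) (simp_all add: a_inv_def, blast+)
  show "f \<otimes>\<^bsub>poly_ring m\<^esub> h \<in> J" "h \<otimes>\<^bsub>poly_ring m\<^esub> f \<in> J"
    if "f \<in> J" "h \<in> carrier (poly_ring m)" for f h
    using mult[OF that] by (simp_all add: mult.commute)
qed

lemma ideal_subset: "ideal J (poly_ring m) \<Longrightarrow> f \<in> J \<Longrightarrow> f \<in> carrier (poly_ring m)"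
  by (rule additive_subgroup.a_Hcarr[OF ideal.axioms(1)])

lemma ideal_0: "ideal J (poly_ring m) \<Longrightarrow> 0 \<in> J"
  using additive_subgroup.zero_closed[OF ideal.axioms(1), of J "poly_ring m"] by simp

lemma ideal_add: "ideal J (poly_ring m) \<Longrightarrow> f \<in> J \<Longrightarrow> h \<in> J \<Longrightarrow> f + h \<in> J"
  using additive_subgroup.a_closed[OF ideal.axioms(1), of J "poly_ring m" f h] by simp

lemma ideal_mult:
  "ideal J (poly_ring m) \<Longrightarrow> f \<in> J \<Longrightarrow> h \<in> carrier (poly_ring m) \<Longrightarrow> h * f \<in> J"
  using ideal.I_l_closed[of J "poly_ring m" f h] by simp

lemma ideal_minus:
  fixes J :: "'k::field mpoly set"
  assumes J: "ideal J (poly_ring m)" and "f \<in> J" "h \<in> J"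
  shows "f - h \<in> J"
proof -
  have "const (- 1) * h \<in> J" by (rule ideal_mult[OF J assms(3) poly_ring_const])
  then have "- h \<in> J" by (simp add: const_def single_uminus)
  from ideal_add[OF J assms(2) this] show ?thesis by simp
qed

lemma ideal_sum:
  "ideal J (poly_ring m) \<Longrightarrow> (\<And>x. x \<in> A \<Longrightarrow> f x \<in> J) \<Longrightarrow> sum f A \<in> J"
  by (induction A rule: infinite_finite_induct) (simp_all add: ideal_0 ideal_add)

lemma mem_cls_iff: "g \<in> cls m J f \<longleftrightarrow> g - f \<in> J"
proof -
  have "g \<in> cls m J f \<longleftrightarrow> (\<exists>h\<in>J. g = h + f)" by (simp add: cls_def a_r_coset_def')
  also have "\<dots> \<longleftrightarrow> g - f \<in> J"
    using diff_add_cancel[of g f, symmetric] by (auto intro: bexI[of _ "g - f"])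
  finally show ?thesis .
qed

lemma cls_eq_iff:
  assumes J: "ideal J (poly_ring m)"
  shows "cls m J f = cls m J h \<longleftrightarrow> f - h \<in> J"
proof
  assume "cls m J f = cls m J h"
  then have "f \<in> cls m J h" using mem_cls_iff[of f m J f] ideal_0[OF J] by simp
  then show "f - h \<in> J" by (simp only: mem_cls_iff)
next
  assume fh: "f - h \<in> J"
  have "g - f \<in> J \<longleftrightarrow> g - h \<in> J" for g
    using ideal_add[OF J _ fh, of "g - f"] ideal_minus[OF J _ fh, of "g - h"] by auto
  then show "cls m J f = cls m J h" by (auto simp: mem_cls_iff)
qed

lemma cls_add:
  assumes "ideal J (poly_ring m)" "f \<in> carrier (poly_ring m)" "h \<in> carrier (poly_ring m)"
  shows "cls m J f \<oplus>\<^bsub>poly_ring m Quot J\<^esub> cls m J h = cls m J (f + h)"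
  using ring_hom_add[OF ideal.rcos_ring_hom[OF assms(1)] assms(2,3)] by (simp add: cls_def)

lemma cls_mult:
  assumes "ideal J (poly_ring m)" "f \<in> carrier (poly_ring m)" "h \<in> carrier (poly_ring m)"
  shows "cls m J f \<otimes>\<^bsub>poly_ring m Quot J\<^esub> cls m J h = cls m J (f * h)"
  using ring_hom_mult[OF ideal.rcos_ring_hom[OF assms(1)] assms(2,3)] by (simp add: cls_def)

lemma cls_in_carrier:
  assumes "ideal J (poly_ring m)" "f \<in> carrier (poly_ring m)"
  shows "cls m J f \<in> carrier (poly_ring m Quot J)"
  using ring_hom_closed[OF ideal.rcos_ring_hom[OF assms(1)] assms(2)] by (simp add: cls_def)

lemma cls_eq_zero:
  assumes J: "ideal J (poly_ring m)" and "f \<in> J"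
  shows "cls m J f = \<zero>\<^bsub>poly_ring m Quot J\<^esub>"
proof -
  have "g \<in> cls m J f \<longleftrightarrow> g \<in> J" for g
    unfolding mem_cls_iff
    using ideal_add[OF J _ assms(2), of "g - f"] ideal_minus[OF J _ assms(2), of g] by auto
  then have "cls m J f = J" by blast
  then show ?thesis by (simp add: FactRing_def)
qed

lemma lift_mult_eq_cls:
  assumes "\<And>f h. f \<in> a \<Longrightarrow> h \<in> b \<Longrightarrow> cls m J (f * h) = C" "a \<noteq> {}" "b \<noteq> {}"
  shows "lift_mult m J a b = C"
proof -
  have "lift_mult m J a b = (\<Union>f\<in>a. \<Union>h\<in>b. cls m J (f * h))"
    by (simp add: lift_mult_def rcoset_mult_def cls_def)
  then show ?thesis using assms by auto
qed

section \<open>A finite-dimensional duality lemma\<close>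

text \<open>In \<open>k\<^sup>A\<close> with \<open>A\<close> finite, a vector orthogonal to the whole annihilator of a subspace \<open>W\<close> lies in
  \<open>W\<close>, at least as far as its values on \<open>A\<close> are concerned. Induction on \<open>A\<close>: if some \<open>w0 \<in> W\<close> does
  not vanish at the new point \<open>a\<close>, subtracting a multiple of \<open>w0\<close> from \<open>\<phi>\<close> reduces the claim to the
  subspace of vectors of \<open>W\<close> vanishing at \<open>a\<close>. It is what turns the functional \<open>vol\<close> into
  multiplication by an element \<open>\<epsilon>\<close>.\<close>

lemma double_annihilator:
  fixes W :: "('a \<Rightarrow> 'k::field) set" and \<phi> :: "'a \<Rightarrow> 'k"
  assumes "finite A"
    and "(\<lambda>_. 0) \<in> W"
    and "\<And>v w c. v \<in> W \<Longrightarrow> w \<in> W \<Longrightarrow> (\<lambda>x. v x + c * w x) \<in> W"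
    and "\<And>v. (\<And>w. w \<in> W \<Longrightarrow> (\<Sum>x\<in>A. v x * w x) = 0) \<Longrightarrow> (\<Sum>x\<in>A. v x * \<phi> x) = 0"
  shows "\<exists>w\<in>W. \<forall>x\<in>A. w x = \<phi> x"
  using assms
proof (induction A arbitrary: W \<phi> rule: finite_induct)
  case empty
  then show ?case by auto
next
  case (insert a A)
  note W0 = insert.prems(1) and lin = insert.prems(2) and ann = insert.prems(3)
  have sum_ins: "(\<Sum>x\<in>insert a A. f x) = f a + (\<Sum>x\<in>A. f x)" for f :: "'a \<Rightarrow> 'k"
    using insert.hyps by simp
  show ?case
  proof (cases "\<exists>w\<in>W. w a \<noteq> 0")
    case False
    have "\<exists>w\<in>W. \<forall>x\<in>A. w x = \<phi> x"
    proof (rule insert.IH[OF W0 lin])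
      fix v assume v: "\<And>w. w \<in> W \<Longrightarrow> (\<Sum>x\<in>A. v x * w x) = 0"
      have restrict: "(\<Sum>x\<in>A. (v(a := 0)) x * f x) = (\<Sum>x\<in>A. v x * f x)" for f
        by (rule sum.cong) (use insert.hyps in auto)
      have "(\<Sum>x\<in>insert a A. (v(a := 0)) x * \<phi> x) = 0"
        by (rule ann) (simp only: sum_ins restrict, simp add: v)
      then show "(\<Sum>x\<in>A. v x * \<phi> x) = 0"
        by (simp only: sum_ins restrict) simp
    qed
    moreover have "(\<Sum>x\<in>insert a A. of_bool (x = a) * \<phi> x) = 0"
      by (rule ann) (use False insert.hyps in \<open>auto simp: sum_ins intro!: sum.neutral\<close>)
    then have "\<phi> a + (\<Sum>x\<in>A. of_bool (x = a) * \<phi> x) = 0" by (simp add: sum_ins)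
    moreover have "(\<Sum>x\<in>A. of_bool (x = a) * \<phi> x) = 0"
      by (rule sum.neutral) (use insert.hyps in auto)
    ultimately show ?thesis using False by auto
  next
    case True
    then obtain w0 where w0: "w0 \<in> W" "w0 a \<noteq> 0" by blast
    define c where "c = \<phi> a / w0 a"
    have "\<exists>w\<in>{w \<in> W. w a = 0}. \<forall>x\<in>A. w x = \<phi> x - c * w0 x"
    proof (rule insert.IH)
      show "(\<lambda>_. 0) \<in> {w \<in> W. w a = 0}" using W0 by simp
      show "(\<lambda>x. v x + d * w x) \<in> {w \<in> W. w a = 0}"
        if "v \<in> {w \<in> W. w a = 0}" "w \<in> {w \<in> W. w a = 0}" for v w d
        using that lin by auto
      fix v assume v: "\<And>w. w \<in> {w \<in> W. w a = 0} \<Longrightarrow> (\<Sum>x\<in>A. v x * w x) = 0"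
      \<comment> \<open>The value at \<open>a\<close> is forced by orthogonality to \<open>w0\<close>.\<close>
      define t where "t = - (\<Sum>x\<in>A. v x * w0 x) / w0 a"
      have upd: "(\<Sum>x\<in>insert a A. (v(a := t)) x * f x) = t * f a + (\<Sum>x\<in>A. v x * f x)" for f
      proof -
        have "(\<Sum>x\<in>A. (v(a := t)) x * f x) = (\<Sum>x\<in>A. v x * f x)"
          by (rule sum.cong) (use insert.hyps in auto)
        then show ?thesis by (simp only: sum_ins) simp
      qed
      have orth0: "t * w0 a + (\<Sum>x\<in>A. v x * w0 x) = 0" using w0(2) by (simp add: t_def)
      have "(\<Sum>x\<in>insert a A. (v(a := t)) x * w x) = 0" if w: "w \<in> W" for w
      proof -
        define d where "d = w a / w0 a"
        have "(\<lambda>x. w x + (- d) * w0 x) \<in> {w \<in> W. w a = 0}"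
          using lin[OF w w0(1), of "- d"] w0(2) by (simp add: d_def)
        from v[OF this] have "(\<Sum>x\<in>A. v x * w x) = d * (\<Sum>x\<in>A. v x * w0 x)"
          by (simp add: algebra_simps sum_subtractf sum_distrib_left)
        moreover have "w a = d * w0 a" using w0(2) by (simp add: d_def)
        ultimately have "t * w a + (\<Sum>x\<in>A. v x * w x) = d * (t * w0 a + (\<Sum>x\<in>A. v x * w0 x))"
          by (simp add: algebra_simps)
        then show ?thesis using orth0 by (simp only: upd) simp
      qed
      then have "t * \<phi> a + (\<Sum>x\<in>A. v x * \<phi> x) = 0" using ann[of "v(a := t)"] upd by metis
      then have "c * (t * w0 a) + (\<Sum>x\<in>A. v x * \<phi> x) = 0"
        using w0(2) by (simp add: c_def algebra_simps)
      moreover have "(\<Sum>x\<in>A. v x * (\<phi> x - c * w0 x)) =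
          (\<Sum>x\<in>A. v x * \<phi> x) - c * (\<Sum>x\<in>A. v x * w0 x)"
        by (simp add: algebra_simps sum_subtractf sum_distrib_left)
      moreover have "c * (t * w0 a) + c * (\<Sum>x\<in>A. v x * w0 x) = 0"
        using orth0 by (simp flip: distrib_left)
      ultimately show "(\<Sum>x\<in>A. v x * (\<phi> x - c * w0 x)) = 0"
        by (simp add: add_eq_0_iff)
    qed
    then obtain w where w: "w \<in> W" "w a = 0" "\<forall>x\<in>A. w x = \<phi> x - c * w0 x" by blast
    have "(\<lambda>x. w x + c * w0 x) \<in> W" by (rule lin[OF w(1) w0(1)])
    moreover have "\<forall>x\<in>insert a A. w x + c * w0 x = \<phi> x" using w w0(2) by (auto simp: c_def)
    ultimately show ?thesis by (intro bexI[of _ "\<lambda>x. w x + c * w0 x"])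
  qed
qed

section \<open>Coordinates of a field over its subfield of p-th powers\<close>

text \<open>Coordinates with respect to a basis of \<open>k\<close> over \<open>k\<^sup>p\<close>. The coordinates are recorded as elements
  of \<open>k\<close> through the inverse of the Frobenius map \<open>k \<rightarrow> k\<^sup>p\<close>, and the basis elements themselves
  serve as indices \<open>b\<close>. As \<open>k\<close> need not be perfect, the basis can be infinite.\<close>

locale frobenius_coordinates =
  fixes p :: nat and coord :: "'k::field \<Rightarrow> 'k \<Rightarrow> 'k"
  assumes char_p: "CHAR('k) = p" and p_pos: "p > 0"
    and coord_add: "coord b (x + y) = coord b x + coord b y"
    and coord_scale: "coord b (a ^ p * x) = a * coord b x"
    and finite_coord: "finite {b. coord b x \<noteq> 0}"
    and sum_coord: "x = (\<Sum>b | coord b x \<noteq> 0. b * coord b x ^ p)"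

text \<open>Scalar multiplication of \<open>x\<close> by \<open>a\<close> through \<open>a\<^sup>p x\<close> makes \<open>k\<close> a vector space over itself, because
  taking \<open>p\<close>-th powers is additive; a basis for this structure is a basis of \<open>k\<close> over \<open>k\<^sup>p\<close>.\<close>

lemma frobenius_coordinates_exist:
  assumes "CHAR('k::field) = p" "p > 0"
  shows "\<exists>coord :: 'k \<Rightarrow> 'k \<Rightarrow> 'k. frobenius_coordinates p coord"
proof -
  have prime: "prime CHAR('k)" using assms by (intro prime_CHAR_semidom) simp
  interpret vector_space "\<lambda>(a::'k) (x::'k). a ^ p * x"
    by unfold_locales
      (auto simp: freshmans_dream[OF prime] assms(1)[symmetric] algebra_simps power_mult_distrib)
  define B where "B = extend_basis {}"
  have B: "independent B" "span B = UNIV"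
    unfolding B_def
    using independent_extend_basis[OF independent_empty] span_extend_basis[OF independent_empty]
    by simp_all
  have "frobenius_coordinates p (\<lambda>b x. representation B x b)"
  proof unfold_locales
    fix b x y a
    show "representation B (x + y) b = representation B x b + representation B y b"
      by (subst representation_add) (use B in auto)
    show "representation B (a ^ p * x) b = a * representation B x b"
      by (subst representation_scale) (use B in auto)
    show "finite {b. representation B x b \<noteq> 0}" by (rule finite_representation)
    show "x = (\<Sum>b | representation B x b \<noteq> 0. b * representation B x b ^ p)"
      using sum_nonzero_representation_eq[OF B(1), of x] B(2) by (simp add: mult.commute)
  qed (use assms in auto)
  then show ?thesis by blast
qed

lemma CHAR_poly_mapping: "CHAR('a::comm_monoid_add \<Rightarrow>\<^sub>0 'k::comm_semiring_1) = CHAR('k)"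
proof (rule CHAR_eqI)
  have *: "(of_nat n :: 'a \<Rightarrow>\<^sub>0 'k) = 0 \<longleftrightarrow> CHAR('k) dvd n" for n
  proof -
    have "(of_nat n :: 'a \<Rightarrow>\<^sub>0 'k) = Poly_Mapping.single 0 (of_nat n)"
      by simp
    moreover have "Poly_Mapping.single 0 c = (0 :: 'a \<Rightarrow>\<^sub>0 'k) \<longleftrightarrow> c = 0" for c
      by (metis lookup_single_eq lookup_zero single_zero)
    ultimately show ?thesis by (simp only: of_nat_eq_0_iff_char_dvd)
  qed
  show "of_nat CHAR('k) = (0 :: 'a \<Rightarrow>\<^sub>0 'k)" by (simp only: *) simp
  show "CHAR('k) dvd n" if "of_nat n = (0 :: 'a \<Rightarrow>\<^sub>0 'k)" for n
    using that by (simp only: *)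
qed

context frobenius_coordinates
begin

lemma prime_CHAR: "prime CHAR('k)"
  using char_p p_pos by (intro prime_CHAR_semidom) simp

lemma sum_power_p: "(\<Sum>x\<in>A. f x) ^ p = (\<Sum>x\<in>A. f x ^ p)" for f :: "'b \<Rightarrow> 'k"
  by (rule freshmans_dream_sum[OF prime_CHAR]) (simp add: char_p)

lemma poly_add_power_p: "(f + h) ^ p = f ^ p + h ^ p" for f h :: "'k mpoly"
  by (rule freshmans_dream) (simp_all add: CHAR_poly_mapping prime_CHAR flip: char_p)

lemma poly_sum_power_p: "(\<Sum>x\<in>A. f x) ^ p = (\<Sum>x\<in>A. f x ^ p)" for f :: "'b \<Rightarrow> 'k mpoly"
  by (rule freshmans_dream_sum) (simp_all add: CHAR_poly_mapping prime_CHAR flip: char_p)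

lemma poly_power_p_eq: "f ^ p = (\<Sum>\<alpha>\<in>keys f. monom (scale_exp p \<alpha>) (lookup f \<alpha> ^ p))"
  for f :: "'k mpoly"
  using arg_cong[OF poly_mapping_sum_monomials[of f], of "\<lambda>h. h ^ p"]
  by (simp add: poly_sum_power_p single_power)

lemma scale_exp_eq_iff: "scale_exp p \<alpha> = scale_exp p \<gamma> \<longleftrightarrow> \<alpha> = \<gamma>"
  using inj_scale_exp_add[OF p_pos, of 0] by (auto dest: injD)

lemma lookup_power_p: "lookup (f ^ p) (scale_exp p \<gamma>) = lookup f \<gamma> ^ p" for f :: "'k mpoly"
  using p_pos
  by (cases "\<gamma> \<in> keys f")
    (auto simp: poly_power_p_eq lookup_sum lookup_single when_def scale_exp_eq_iff
      not_in_keys_iff_lookup_eq_zero)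

lemma lookup_power_p_eq_0:
  fixes f :: "'k mpoly"
  assumes "\<And>\<gamma>. \<alpha> \<noteq> scale_exp p \<gamma>"
  shows "lookup (f ^ p) \<alpha> = 0"
  unfolding poly_power_p_eq lookup_sum
  by (rule sum.neutral) (use assms[symmetric] in \<open>simp add: lookup_single_not_eq\<close>)

lemma coord_0: "coord b 0 = 0"
  using coord_scale[of b 0 0] p_pos by simp

lemma coord_sum: "coord b (sum f A) = (\<Sum>x\<in>A. coord b (f x))"
  by (induction A rule: infinite_finite_induct) (simp_all add: coord_0 coord_add)

lemma coord_eqI:
  assumes "\<And>b. coord b x = 0"
  shows "x = 0"
  by (subst sum_coord) (simp add: assms)

text \<open>The monomials \<open>x\<^sup>\<beta>\<close> with all exponents below \<open>p\<close>, multiplied by the elements of a basis of \<open>k\<close>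
  over \<open>k\<^sup>p\<close>, form a basis of \<open>S\<close> over its subring \<open>S\<^sup>p\<close> of \<open>p\<close>-th powers. The Cartier operator
  \<open>cartier \<beta> b\<close> is, for such \<open>\<beta>\<close>, the \<open>p\<close>-th root of the coordinate belonging to \<open>b x\<^sup>\<beta>\<close>.\<close>

definition cartier :: "(nat \<Rightarrow>\<^sub>0 nat) \<Rightarrow> 'k \<Rightarrow> 'k mpoly \<Rightarrow> 'k mpoly" where
  "cartier \<beta> b f = Poly_Mapping.map (coord b) (Poly_Mapping.map_key (\<lambda>\<gamma>. scale_exp p \<gamma> + \<beta>) f)"

lemma lookup_cartier: "lookup (cartier \<beta> b f) \<gamma> = coord b (lookup f (scale_exp p \<gamma> + \<beta>))"
  by (simp add: cartier_def Poly_Mapping.map.rep_eq when_def coord_0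
      Poly_Mapping.map_key.rep_eq[OF inj_scale_exp_add[OF p_pos]])

lemma cartier_add: "cartier \<beta> b (f + h) = cartier \<beta> b f + cartier \<beta> b h"
  by (rule poly_mapping_eqI) (simp add: lookup_cartier lookup_add coord_add)

lemma cartier_0: "cartier \<beta> b 0 = 0"
  by (rule poly_mapping_eqI) (simp add: lookup_cartier coord_0)

lemma cartier_sum: "cartier \<beta> b (sum f A) = (\<Sum>x\<in>A. cartier \<beta> b (f x))"
  by (induction A rule: infinite_finite_induct) (simp_all add: cartier_0 cartier_add)

lemma cartier_carrier:
  assumes "f \<in> carrier (poly_ring m)"
  shows "cartier \<beta> b f \<in> carrier (poly_ring m)"
  unfolding in_poly_ring_iff
proof
  fix \<gamma> assume "\<gamma> \<in> keys (cartier \<beta> b f)"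
  then have "scale_exp p \<gamma> + \<beta> \<in> keys f"
    by (metis coord_0 in_keys_iff lookup_cartier)
  then have "keys (scale_exp p \<gamma> + \<beta>) \<subseteq> {..<m}" using assms by (simp add: in_poly_ring_iff)
  then show "keys \<gamma> \<subseteq> {..<m}" by (simp add: keys_exp_add keys_scale_exp p_pos)
qed

text \<open>Multiplying by \<open>x\<^sup>\<sigma>\<close> moves the coordinate of \<open>x\<^sup>\<beta>\<close> to that of \<open>x\<^bsup>\<beta>+\<sigma>\<^esup>\<close>, provided no exponent reaches
  \<open>p\<close>: then the exponents in the residue class of \<open>\<beta> + \<sigma>\<close> that dominate \<open>p\<gamma> + \<sigma>\<close> are exactly the
  \<open>p\<alpha> + \<beta> + \<sigma>\<close> with \<open>\<gamma> \<le> \<alpha>\<close>. A \<open>p\<close>-th power is a scalar for the coordinates and comes out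
  as its root.\<close>

lemma cartier_monom_mult:
  assumes small: "\<And>i. lookup (\<beta> + \<sigma>) i < p"
  shows "cartier (\<beta> + \<sigma>) b (monom (scale_exp p \<gamma> + \<sigma>) (c ^ p) * f) = monom \<gamma> c * cartier \<beta> b f"
proof (rule poly_mapping_eqI)
  fix \<alpha>
  show "lookup (cartier (\<beta> + \<sigma>) b (monom (scale_exp p \<gamma> + \<sigma>) (c ^ p) * f)) \<alpha> =
    lookup (monom \<gamma> c * cartier \<beta> b f) \<alpha>"
  proof (cases "\<exists>\<delta>. \<alpha> = \<gamma> + \<delta>")
    case True
    then obtain \<delta> where \<alpha>: "\<alpha> = \<gamma> + \<delta>" by blast
    have "scale_exp p \<alpha> + (\<beta> + \<sigma>) = (scale_exp p \<gamma> + \<sigma>) + (scale_exp p \<delta> + \<beta>)"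
      by (simp add: \<alpha> scale_exp_add add_ac)
    then have "lookup (monom (scale_exp p \<gamma> + \<sigma>) (c ^ p) * f) (scale_exp p \<alpha> + (\<beta> + \<sigma>)) =
        c ^ p * lookup f (scale_exp p \<delta> + \<beta>)"
      by (simp only: lookup_single_times_add)
    then show ?thesis by (simp add: lookup_cartier \<alpha> lookup_single_times_add coord_scale)
  next
    case False
    have "scale_exp p \<alpha> + (\<beta> + \<sigma>) \<noteq> (scale_exp p \<gamma> + \<sigma>) + \<delta>" for \<delta>
    proof
      assume eq: "scale_exp p \<alpha> + (\<beta> + \<sigma>) = (scale_exp p \<gamma> + \<sigma>) + \<delta>"
      have "lookup \<gamma> i \<le> lookup \<alpha> i" for i
      proof (rule ccontr)
        assume "\<not> ?thesis"
        then have "p * Suc (lookup \<alpha> i) \<le> p * lookup \<gamma> i" by (intro mult_le_mono2) simp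
        then show False
          using arg_cong[OF eq, of "\<lambda>\<delta>. lookup \<delta> i"] small[of i] by (simp add: lookup_add)
      qed
      then have "\<alpha> = \<gamma> + (\<alpha> - \<gamma>)"
        by (intro poly_mapping_eqI) (simp add: lookup_add lookup_minus)
      then show False using False by blast
    qed
    then show ?thesis
      using False by (simp add: lookup_cartier lookup_single_times_eq_0 coord_0)
  qed
qed

lemma cartier_power_mult:
  assumes "\<And>i. lookup \<beta> i < p"
  shows "cartier \<beta> b (g ^ p * f) = g * cartier \<beta> b f"
proof -
  have "cartier \<beta> b (g ^ p * f) =
      (\<Sum>\<gamma>\<in>keys g. cartier \<beta> b (monom (scale_exp p \<gamma>) (lookup g \<gamma> ^ p) * f))"
    by (simp add: poly_power_p_eq sum_distrib_right cartier_sum)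
  also have "\<dots> = (\<Sum>\<gamma>\<in>keys g. monom \<gamma> (lookup g \<gamma>) * cartier \<beta> b f)"
    by (rule sum.cong) (use cartier_monom_mult[of \<beta> 0] assms in simp_all)
  also have "\<dots> = g * cartier \<beta> b f"
    by (simp only: poly_mapping_sum_monomials flip: sum_distrib_right)
  finally show ?thesis .
qed

definition residues :: "nat \<Rightarrow> (nat \<Rightarrow>\<^sub>0 nat) set" where
  "residues m = {\<beta>. keys \<beta> \<subseteq> {..<m} \<and> (\<forall>i. lookup \<beta> i < p)}"

lemma finite_residues: "finite (residues m)"
  by (rule finite_subset[OF _ finite_bounded_exponents[of m p]])
    (auto simp: residues_def less_imp_le)

lemma scale_exp_add_eq:
  assumes "scale_exp p \<gamma> + \<beta> = scale_exp p \<gamma>' + \<beta>'"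
    and "\<And>i. lookup \<beta> i < p" "\<And>i. lookup \<beta>' i < p"
  shows "\<beta> = \<beta>'"
proof (rule poly_mapping_eqI)
  fix i
  have "(p * lookup \<gamma> i + lookup \<beta> i) mod p = (p * lookup \<gamma>' i + lookup \<beta>' i) mod p"
    using arg_cong[OF assms(1), of "\<lambda>\<delta>. lookup \<delta> i"] by (simp add: lookup_add)
  then show "lookup \<beta> i = lookup \<beta>' i" using assms(2,3) by simp
qed

lemma exponent_division:
  obtains \<gamma> \<beta> where "\<alpha> = scale_exp p \<gamma> + \<beta>" "\<And>i. lookup \<beta> i < p"
proof
  let ?\<gamma> = "Poly_Mapping.map (\<lambda>n. n div p) \<alpha>" and ?\<beta> = "Poly_Mapping.map (\<lambda>n. n mod p) \<alpha>"
  show "\<alpha> = scale_exp p ?\<gamma> + ?\<beta>"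
    by (rule poly_mapping_eqI) (auto simp: lookup_add Poly_Mapping.map.rep_eq when_def)
  show "lookup ?\<beta> i < p" for i
    using p_pos by (auto simp: Poly_Mapping.map.rep_eq when_def)
qed

text \<open>Every exponent is uniquely \<open>p\<gamma> + \<beta>\<close> with \<open>\<beta>\<close> below \<open>p\<close>, so at each exponent only one \<open>\<beta>\<close>
  contributes, and the remaining sum over \<open>b\<close> is the expansion of the coefficient of \<open>f\<close> over
  \<open>k\<^sup>p\<close>.\<close>

lemma cartier_decomposition:
  assumes f: "f \<in> carrier (poly_ring m)"
  shows "f = (\<Sum>\<beta>\<in>residues m. \<Sum>b\<in>(\<Union>\<alpha>\<in>keys f. {b. coord b (lookup f \<alpha>) \<noteq> 0}).
    monom \<beta> b * cartier \<beta> b f ^ p)"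
    (is "f = (\<Sum>\<beta>\<in>_. \<Sum>b\<in>?B. ?t \<beta> b)")
proof (rule poly_mapping_eqI)
  fix \<alpha>
  have fin: "finite ?B" by (simp add: finite_coord)
  obtain \<gamma> \<beta>\<^sub>0 where \<alpha>: "\<alpha> = scale_exp p \<gamma> + \<beta>\<^sub>0" and small: "\<And>i. lookup \<beta>\<^sub>0 i < p"
    using exponent_division by blast
  have other: "lookup (?t \<beta> b) \<alpha> = 0" if "\<beta> \<in> residues m" "\<beta> \<noteq> \<beta>\<^sub>0" for \<beta> b
  proof (cases "\<exists>\<delta>. \<alpha> = \<beta> + \<delta>")
    case True
    then obtain \<delta> where \<delta>: "\<alpha> = \<beta> + \<delta>" by blast
    have "\<delta> \<noteq> scale_exp p \<gamma>'" for \<gamma>'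
    proof
      assume "\<delta> = scale_exp p \<gamma>'"
      then have "scale_exp p \<gamma> + \<beta>\<^sub>0 = scale_exp p \<gamma>' + \<beta>" using \<alpha> \<delta> by (simp add: add.commute)
      from scale_exp_add_eq[OF this small] show False using that by (auto simp: residues_def)
    qed
    then show ?thesis by (simp add: \<delta> lookup_single_times_add lookup_power_p_eq_0)
  qed (simp add: lookup_single_times_eq_0)
  have same: "lookup (?t \<beta>\<^sub>0 b) \<alpha> = b * coord b (lookup f \<alpha>) ^ p" for b
    by (simp add: \<alpha> add.commute[of "scale_exp p \<gamma>"] lookup_single_times_add lookup_power_p
        lookup_cartier)
  have "lookup (\<Sum>\<beta>\<in>residues m. \<Sum>b\<in>?B. ?t \<beta> b) \<alpha> =
      (\<Sum>\<beta>\<in>residues m. \<Sum>b\<in>?B. lookup (?t \<beta> b) \<alpha>)"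
    by (simp add: lookup_sum)
  also have "\<dots> = (\<Sum>\<beta>\<in>residues m \<inter> {\<beta>\<^sub>0}. \<Sum>b\<in>?B. lookup (?t \<beta> b) \<alpha>)"
    by (rule sum.mono_neutral_right) (auto simp: finite_residues other)
  also have "\<dots> = lookup f \<alpha>"
  proof (cases "\<alpha> \<in> keys f")
    case True
    then have "keys \<alpha> \<subseteq> {..<m}" using f by (simp add: in_poly_ring_iff)
    then have "\<beta>\<^sub>0 \<in> residues m" using small by (simp add: residues_def \<alpha> keys_exp_add)
    then have "(\<Sum>\<beta>\<in>residues m \<inter> {\<beta>\<^sub>0}. \<Sum>b\<in>?B. lookup (?t \<beta> b) \<alpha>) =
        (\<Sum>b\<in>?B. b * coord b (lookup f \<alpha>) ^ p)"
      by (simp add: same)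
    also have "\<dots> = (\<Sum>b | coord b (lookup f \<alpha>) \<noteq> 0. b * coord b (lookup f \<alpha>) ^ p)"
      by (rule sum.mono_neutral_right) (use True fin p_pos in auto)
    also have "\<dots> = lookup f \<alpha>" by (rule sum_coord[symmetric])
    finally show ?thesis .
  next
    case False
    then have "lookup f \<alpha> = 0" by (simp add: in_keys_iff)
    then have zero: "lookup (?t \<beta> b) \<alpha> = 0" if "\<beta> \<in> residues m \<inter> {\<beta>\<^sub>0}" for \<beta> b
      using that p_pos by (auto simp: same coord_0)
    have "(\<Sum>\<beta>\<in>residues m \<inter> {\<beta>\<^sub>0}. \<Sum>b\<in>?B. lookup (?t \<beta> b) \<alpha>) = 0"
      by (intro sum.neutral ballI zero)
    then show ?thesis using \<open>lookup f \<alpha> = 0\<close> by simp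
  qed
  finally show "lookup f \<alpha> = lookup (\<Sum>\<beta>\<in>residues m. \<Sum>b\<in>?B. ?t \<beta> b) \<alpha>" by simp
qed

end

section \<open>Functionals dual to an ideal and to its Frobenius power\<close>

definition functional :: "(nat \<Rightarrow>\<^sub>0 nat) set \<Rightarrow> ((nat \<Rightarrow>\<^sub>0 nat) \<Rightarrow> 'k::field) \<Rightarrow> 'k mpoly \<Rightarrow> 'k" where
  "functional A L f = (\<Sum>\<alpha>\<in>A. lookup f \<alpha> * L \<alpha>)"

lemma functional_add: "functional A L (f + h) = functional A L f + functional A L h"
  by (simp add: functional_def lookup_add distrib_right sum.distrib)

lemma functional_minus: "functional A L (f - h) = functional A L f - functional A L h"
  by (simp add: functional_def lookup_minus left_diff_distrib sum_subtractf)

lemma functional_const_mult: "functional A L (const c * f) = c * functional A L f"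
  by (simp add: functional_def lookup_const_times sum_distrib_left mult.assoc)

text \<open>The functional \<open>\<Lambda>'\<close> that sends \<open>c x\<^sup>q (x\<^sup>\<alpha>)\<^sup>p\<close> to \<open>c \<Lambda>(x\<^sup>\<alpha>)\<^sup>p\<close> and kills the monomials that are not of this
  form. For \<open>q = (p-1, \<dots>, p-1)\<close> it is the projection of \<open>S\<close> onto the top summand
  \<open>x\<^sup>q k[x\<^sub>0\<^sup>p, \<dots>]\<close> followed by the Frobenius twist of \<open>\<Lambda>\<close>.\<close>

definition frobenius_functional ::
    "nat \<Rightarrow> (nat \<Rightarrow>\<^sub>0 nat) \<Rightarrow> (nat \<Rightarrow>\<^sub>0 nat) set \<Rightarrow> ((nat \<Rightarrow>\<^sub>0 nat) \<Rightarrow> 'k::field) \<Rightarrow> 'k mpoly \<Rightarrow> 'k"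
  where "frobenius_functional p q A L f = (\<Sum>\<alpha>\<in>A. lookup f (scale_exp p \<alpha> + q) * L \<alpha> ^ p)"

lemma frobenius_functional_add:
  "frobenius_functional p q A L (f + h) = frobenius_functional p q A L f + frobenius_functional p q A L h"
  by (simp add: frobenius_functional_def lookup_add distrib_right sum.distrib)

lemma frobenius_functional_minus:
  "frobenius_functional p q A L (f - h) = frobenius_functional p q A L f - frobenius_functional p q A L h"
  by (simp add: frobenius_functional_def lookup_minus left_diff_distrib sum_subtractf)

lemma frobenius_functional_const_mult:
  "frobenius_functional p q A L (const c * f) = c * frobenius_functional p q A L f"
  by (simp add: frobenius_functional_def lookup_const_times sum_distrib_left mult.assoc)

lemma frobenius_functional_0: "frobenius_functional p q A L 0 = 0"
  by (simp add: frobenius_functional_def)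

lemma frobenius_functional_sum:
  "frobenius_functional p q A L (sum f X) = (\<Sum>x\<in>X. frobenius_functional p q A L (f x))"
  by (induction X rule: infinite_finite_induct)
    (simp_all add: frobenius_functional_0 frobenius_functional_add)

lemma functional_sum: "functional A L (sum f X) = (\<Sum>x\<in>X. functional A L (f x))"
  by (induction X rule: infinite_finite_induct) (simp_all add: functional_add, simp_all add: functional_def)

lemma functional_other_degree:
  assumes "f \<in> hom_part m d" "d \<noteq> s"
  shows "functional (exps m s) L f = 0"
  unfolding functional_def
  by (rule sum.neutral) (use assms in \<open>auto simp: hom_part_lookup exps_def\<close>)

lemma frobenius_functional_other_degree:
  assumes "f \<in> hom_part m d" "d \<noteq> p * s + m * (p - 1)"
  shows "frobenius_functional p (top_exp m p) (exps m s) L f = 0"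
  unfolding frobenius_functional_def
proof (rule sum.neutral, rule ballI)
  fix \<alpha> assume "\<alpha> \<in> exps m s"
  then have "exp_deg (scale_exp p \<alpha> + top_exp m p) = p * s + m * (p - 1)"
    by (simp add: exps_def exp_deg_add exp_deg_scale exp_deg_top_exp)
  then show "lookup f (scale_exp p \<alpha> + top_exp m p) * L \<alpha> ^ p = 0"
    using assms by (auto simp: hom_part_lookup exps_def)
qed

context frobenius_coordinates
begin

text \<open>Through the coordinates of \<open>k\<close> over \<open>k\<^sup>p\<close>, \<open>\<Lambda>'\<close> is controlled by \<open>\<Lambda>\<close>; this reduces all
  vanishing statements on \<open>\<Lambda>'\<close> to statements on \<open>\<Lambda>\<close>.\<close>

lemma coord_frobenius_functional:
  "coord b (frobenius_functional p q A L f) = functional A L (cartier q b f)"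
proof -
  have "coord b (x * a ^ p) = coord b x * a" for x a
    using coord_scale[of b a x] by (simp add: mult.commute)
  then show ?thesis
    by (simp add: frobenius_functional_def functional_def coord_sum lookup_cartier)
qed

lemma frobenius_functional_top_times_power:
  "frobenius_functional p q A L (monom q 1 * f ^ p) = functional A L f ^ p" for f :: "'k mpoly"
  by (simp add: frobenius_functional_def functional_def add.commute[of _ q] lookup_single_times_add
      lookup_power_p sum_power_p power_mult_distrib)

lemma top_exp_small: "lookup (top_exp m p) i < p"
  using p_pos by (simp add: lookup_top_exp)

text \<open>The Cartier operator takes \<open>g\<^sup>p h\<close> to \<open>g\<close> times a polynomial, hence into \<open>I\<close>.\<close>

lemma frobenius_functional_power_mult_eq_0:
  fixes I :: "'k mpoly set"
  assumes I: "ideal I (poly_ring m)" "\<And>f. f \<in> I \<Longrightarrow> functional A L f = 0"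
    and "g \<in> I" "h \<in> carrier (poly_ring m)"
  shows "frobenius_functional p (top_exp m p) A L (g ^ p * h) = 0"
proof (rule coord_eqI)
  fix b
  have "cartier (top_exp m p) b h * g \<in> I"
    by (rule ideal_mult[OF I(1) assms(3) cartier_carrier[OF assms(4)]])
  then have "functional A L (g * cartier (top_exp m p) b h) = 0"
    using I(2) by (simp add: mult.commute)
  then show "coord b (frobenius_functional p (top_exp m p) A L (g ^ p * h)) = 0"
    by (simp add: coord_frobenius_functional cartier_power_mult[OF top_exp_small])
qed

text \<open>The converse inclusion: whatever \<open>\<Lambda>'\<close> annihilates together with its multiples lies in the
  Frobenius power. Multiplying \<open>f\<close> by \<open>x\<^sup>\<sigma>\<close> with \<open>\<beta> + \<sigma> = (p-1, \<dots>, p-1)\<close> moves the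
  coordinate of \<open>f\<close> at \<open>x\<^sup>\<beta>\<close> to the top, where \<open>\<Lambda>'\<close> sees it. So each coordinate is annihilated by
  \<open>\<Lambda>\<close> with all its multiples, hence is in \<open>I\<close>, and \<open>f\<close> is a combination of \<open>p\<close>-th powers of
  coordinates.\<close>

lemma mem_frobenius_power:
  fixes I J :: "'k mpoly set"
  assumes J: "ideal J (poly_ring m)" "\<And>g. g \<in> I \<Longrightarrow> g ^ p \<in> J"
    and nondeg: "\<And>f. f \<in> carrier (poly_ring m) \<Longrightarrow>
      (\<And>\<gamma>. keys \<gamma> \<subseteq> {..<m} \<Longrightarrow> functional A L (monom \<gamma> 1 * f) = 0) \<Longrightarrow> f \<in> I"
    and f: "f \<in> carrier (poly_ring m)"
    and ann: "\<And>\<delta>. keys \<delta> \<subseteq> {..<m} \<Longrightarrow>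
      frobenius_functional p (top_exp m p) A L (monom \<delta> 1 * f) = 0"
  shows "f \<in> J"
proof -
  have "cartier \<beta> b f \<in> I" if \<beta>: "\<beta> \<in> residues m" for \<beta> b
  proof (rule nondeg[OF cartier_carrier[OF f]])
    fix \<gamma> :: "nat \<Rightarrow>\<^sub>0 nat" assume \<gamma>: "keys \<gamma> \<subseteq> {..<m}"
    define \<sigma> where "\<sigma> = top_exp m p - \<beta>"
    have top: "\<beta> + \<sigma> = top_exp m p"
    proof (rule poly_mapping_eqI)
      fix i
      have "lookup \<beta> i \<le> lookup (top_exp m p) i"
      proof (cases "i < m")
        case True
        have "lookup \<beta> i < p" using \<beta> by (simp add: residues_def)
        then show ?thesis using True by (simp add: lookup_top_exp)
      next
        case False
        then have "i \<notin> keys \<beta>" using \<beta> by (auto simp: residues_def)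
        then show ?thesis by (simp add: in_keys_iff)
      qed
      then show "lookup (\<beta> + \<sigma>) i = lookup (top_exp m p) i"
        by (simp add: \<sigma>_def lookup_add lookup_minus)
    qed
    have "keys \<sigma> \<subseteq> {..<m}" using top keys_top_exp[of m p] keys_exp_add[of \<beta> \<sigma>] by auto
    then have "keys (scale_exp p \<gamma> + \<sigma>) \<subseteq> {..<m}"
      using \<gamma> by (simp add: keys_exp_add keys_scale_exp p_pos)
    then have "functional A L (cartier (\<beta> + \<sigma>) b (monom (scale_exp p \<gamma> + \<sigma>) (1 ^ p) * f)) = 0"
      using ann by (simp add: top coord_0 flip: coord_frobenius_functional)
    moreover have "cartier (\<beta> + \<sigma>) b (monom (scale_exp p \<gamma> + \<sigma>) (1 ^ p) * f) =
        monom \<gamma> 1 * cartier \<beta> b f"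
      by (rule cartier_monom_mult) (simp add: top top_exp_small)
    ultimately show "functional A L (monom \<gamma> 1 * cartier \<beta> b f) = 0" by simp
  qed
  then have "monom \<beta> b * cartier \<beta> b f ^ p \<in> J" if "\<beta> \<in> residues m" for \<beta> b
    using that by (intro ideal_mult[OF J(1)] J(2) poly_ring_monom) (auto simp: residues_def)
  then show ?thesis
    by (subst cartier_decomposition[OF f]) (intro ideal_sum[OF J(1)])
qed

end

section \<open>The volume functional of a graded Gorenstein algebra\<close>

text \<open>The polynomials all of whose homogeneous components lie in the ideal form an ideal containing \<open>G\<close>.\<close>

lemma genideal_homogeneous:
  fixes G :: "'k::field mpoly set"
  assumes G: "\<And>g. g \<in> G \<Longrightarrow> \<exists>e. g \<in> hom_part m e"
    and f: "f \<in> genideal (poly_ring m) G"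
  shows "hom_comp d f \<in> genideal (poly_ring m) G"
proof -
  interpret cring "poly_ring m :: 'k mpoly ring" by (rule cring_poly_ring)
  let ?I = "genideal (poly_ring m) G"
  let ?J = "{f \<in> carrier (poly_ring m). \<forall>d. hom_comp d f \<in> ?I}"
  have GS: "G \<subseteq> carrier (poly_ring m)" using G hom_part_carrier by blast
  have I: "ideal ?I (poly_ring m)" by (rule genideal_ideal[OF GS])
  have "ideal ?J (poly_ring m)"
  proof (rule ideal_poly_ringI)
    fix f h :: "'k mpoly" assume f: "f \<in> ?J" and h: "h \<in> carrier (poly_ring m)"
    have "hom_comp d (h * f) \<in> ?I" for d
    proof -
      have "h * f = (\<Sum>\<gamma>\<in>keys h. monom \<gamma> (lookup h \<gamma>) * f)"
        by (simp only: poly_mapping_sum_monomials flip: sum_distrib_right)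
      then have "hom_comp d (h * f) = (\<Sum>\<gamma>\<in>keys h. hom_comp d (monom \<gamma> (lookup h \<gamma>) * f))"
        by (simp add: hom_comp_sum)
      moreover have "hom_comp d (monom \<gamma> (lookup h \<gamma>) * f) \<in> ?I" if "\<gamma> \<in> keys h" for \<gamma>
      proof -
        have "monom \<gamma> (lookup h \<gamma>) * hom_comp (d - exp_deg \<gamma>) f \<in> ?I"
          by (rule ideal_mult[OF I]) (use f h that in \<open>auto simp: poly_ring_monom in_poly_ring_iff\<close>)
        then show ?thesis using ideal_0[OF I] by (simp add: hom_comp_monom_mult)
      qed
      ultimately show ?thesis by (simp add: ideal_sum[OF I])
    qed
    then show "h * f \<in> ?J" using f h by (simp add: poly_ring_mult_closed)
  qed (auto simp: poly_ring_0 hom_comp_0 hom_comp_add poly_ring_add_closed ideal_0[OF I] ideal_add[OF I])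
  moreover have "G \<subseteq> ?J"
  proof
    fix g assume g: "g \<in> G"
    then obtain e where "g \<in> hom_part m e" using G by blast
    then show "g \<in> ?J"
      using genideal_self[OF GS] g GS ideal_0[OF I] by (auto simp: hom_comp_homogeneous)
  qed
  ultimately have "?I \<subseteq> ?J" by (rule genideal_minimal)
  then show ?thesis using f by blast
qed

text \<open>The images of the powers of the maximal homogeneous ideal form a descending chain. Once it is
  constant, a monomial of degree \<open>d\<close> is congruent modulo \<open>I\<close> to a polynomial without terms of
  degree \<open>d\<close>, and since \<open>I\<close> is homogeneous the degree \<open>d\<close> part of the difference is in \<open>I\<close>.\<close>

lemma artinian_imp_high_degree_mem:
  fixes I :: "'k::field mpoly set"
  assumes I: "ideal I (poly_ring m)" and hom: "\<And>f d. f \<in> I \<Longrightarrow> hom_comp d f \<in> I"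
    and art: "artinian (poly_ring m Quot I)"
  shows "\<exists>N. \<forall>\<alpha>. keys \<alpha> \<subseteq> {..<m} \<longrightarrow> N \<le> exp_deg \<alpha> \<longrightarrow> monom \<alpha> 1 \<in> I"
proof -
  interpret cring "poly_ring m :: 'k mpoly ring" by (rule cring_poly_ring)
  define T :: "nat \<Rightarrow> 'k mpoly set" where
    "T i = {f \<in> carrier (poly_ring m). \<forall>\<alpha>\<in>keys f. i \<le> exp_deg \<alpha>}" for i
  have T: "ideal (T i) (poly_ring m)" for i
  proof (rule ideal_poly_ringI)
    show "f + h \<in> T i" if "f \<in> T i" "h \<in> T i" for f h
      using that keys_add[of f h] by (auto simp: T_def poly_ring_add_closed)
    fix f h :: "'k mpoly" assume f: "f \<in> T i" and h: "h \<in> carrier (poly_ring m)"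
    have "i \<le> exp_deg \<alpha>" if "\<alpha> \<in> keys (h * f)" for \<alpha>
    proof -
      obtain a b where "\<alpha> = a + b" "b \<in> keys f" using keys_mult[of h f] \<open>\<alpha> \<in> keys (h * f)\<close> by blast
      then show ?thesis using f by (auto simp: T_def exp_deg_add intro: trans_le_add2)
    qed
    then show "h * f \<in> T i" using f h by (simp add: T_def poly_ring_mult_closed)
  qed (auto simp: T_def poly_ring_0)
  have "\<forall>i. ideal (cls m I ` T i) (poly_ring m Quot I) \<and> cls m I ` T (Suc i) \<subseteq> cls m I ` T i"
  proof (intro allI conjI)
    fix i
    show "ideal (cls m I ` T i) (poly_ring m Quot I)"
      using ring_ideal_imp_quot_ideal[OF I T, of i] by (simp add: cls_def[abs_def])
    show "cls m I ` T (Suc i) \<subseteq> cls m I ` T i"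
      by (rule image_mono) (auto simp: T_def)
  qed
  then obtain N where N: "\<And>i. i \<ge> N \<Longrightarrow> cls m I ` T i = cls m I ` T N"
    using art unfolding artinian_def by meson
  have "monom \<alpha> 1 \<in> I" if \<alpha>: "keys \<alpha> \<subseteq> {..<m}" "N \<le> exp_deg \<alpha>" for \<alpha>
  proof -
    let ?d = "exp_deg \<alpha>"
    have "monom \<alpha> 1 \<in> T ?d" using \<alpha> by (simp add: T_def poly_ring_monom)
    then have "cls m I (monom \<alpha> 1) \<in> cls m I ` T (Suc ?d)"
      using N[of ?d] N[of "Suc ?d"] \<alpha>(2) by auto
    then obtain h where h: "h \<in> T (Suc ?d)" "cls m I (monom \<alpha> 1) = cls m I h" by blast
    then have "hom_comp ?d (monom \<alpha> 1 - h) \<in> I" using hom by (simp add: cls_eq_iff[OF I])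
    moreover have "hom_comp ?d (monom \<alpha> 1 - h) = monom \<alpha> 1"
    proof (rule poly_mapping_eqI)
      fix \<beta>
      have "lookup h \<beta> = 0" if "exp_deg \<beta> = ?d"
        using h(1) that by (force simp: T_def in_keys_iff)
      then show "lookup (hom_comp ?d (monom \<alpha> 1 - h)) \<beta> = lookup (monom \<alpha> 1) \<beta>"
        by (auto simp: lookup_hom_comp lookup_minus lookup_single when_def)
    qed
    ultimately show ?thesis by simp
  qed
  then show ?thesis by blast
qed

lemma linear_functional_cls_add:
  assumes I: "ideal I (poly_ring m)" and \<phi>: "linear_functional m I d \<phi>"
    and "f \<in> hom_part m d" "h \<in> hom_part m d"
  shows "\<phi> (cls m I (f + h)) = \<phi> (cls m I f) + \<phi> (cls m I h)"
  using \<phi> assms(3,4)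
  unfolding linear_functional_def graded_piece_def
  by (simp add: cls_add[OF I, symmetric] hom_part_carrier)

lemma linear_functional_cls_const_mult:
  assumes I: "ideal I (poly_ring m)" and \<phi>: "linear_functional m I d \<phi>"
    and "f \<in> hom_part m d"
  shows "\<phi> (cls m I (const c * f)) = c * \<phi> (cls m I f)"
  using \<phi> assms(3)
  unfolding linear_functional_def graded_piece_def
  by (simp add: cls_mult[OF I, symmetric] hom_part_carrier poly_ring_const)

lemma linear_functional_cls_0:
  assumes "ideal I (poly_ring m)" "linear_functional m I d \<phi>"
  shows "\<phi> (cls m I 0) = 0"
  using linear_functional_cls_const_mult[OF assms hom_part_0, of 0] by simp

lemma linear_functional_eq_functional:
  assumes I: "ideal I (poly_ring m)" and \<phi>: "linear_functional m I d \<phi>"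
    and f: "f \<in> hom_part m d"
  shows "\<phi> (cls m I f) = functional (exps m d) (\<lambda>\<alpha>. \<phi> (cls m I (monom \<alpha> 1))) f"
proof -
  have "\<phi> (cls m I (\<Sum>\<alpha>\<in>X. monom \<alpha> (lookup f \<alpha>))) =
      (\<Sum>\<alpha>\<in>X. lookup f \<alpha> * \<phi> (cls m I (monom \<alpha> 1)))"
    if "finite X" "X \<subseteq> exps m d" for X
    using that
  proof (induction X rule: finite_induct)
    case empty
    then show ?case using linear_functional_cls_0[OF I \<phi>] by simp
  next
    case (insert \<alpha> X)
    have "monom \<alpha> (lookup f \<alpha>) = const (lookup f \<alpha>) * monom \<alpha> 1"
      by (simp add: const_def mult_single)
    then have "\<phi> (cls m I (monom \<alpha> (lookup f \<alpha>))) = lookup f \<alpha> * \<phi> (cls m I (monom \<alpha> 1))"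
      using linear_functional_cls_const_mult[OF I \<phi>, of "monom \<alpha> 1"] insert.prems
      by (simp add: hom_part_monom)
    moreover have "(\<Sum>\<alpha>\<in>X. monom \<alpha> (lookup f \<alpha>)) \<in> hom_part m d"
      by (rule hom_part_sum) (use insert.prems in \<open>auto intro: hom_part_monom\<close>)
    ultimately show ?case
      using insert linear_functional_cls_add[OF I \<phi>, of "monom \<alpha> (lookup f \<alpha>)"
          "\<Sum>\<alpha>\<in>X. monom \<alpha> (lookup f \<alpha>)"]
      by (simp add: hom_part_monom)
  qed
  from this[OF finite_exps order_refl] show ?thesis
    by (simp add: functional_def flip: hom_part_sum_monomials[OF f])
qed

lemma functional_hom_comp:
  "functional (exps m s) L (hom_comp s f) = functional (exps m s) L f"
  by (simp add: functional_def lookup_hom_comp exps_def)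

text \<open>Homogeneity of \<open>I\<close> enters here: the functional sees only the degree \<open>s\<close> part of \<open>f\<close>, and that
  part is again in \<open>I\<close>.\<close>

lemma volume_functional_eq_0:
  assumes I: "ideal I (poly_ring m)" and hom: "\<And>f d. f \<in> I \<Longrightarrow> hom_comp d f \<in> I"
    and \<phi>: "linear_functional m I s \<phi>" and f: "f \<in> I"
  shows "functional (exps m s) (\<lambda>\<alpha>. \<phi> (cls m I (monom \<alpha> 1))) f = 0"
proof -
  have "hom_comp s f \<in> hom_part m s"
    by (rule hom_comp_hom_part[OF ideal_subset[OF I f]])
  moreover have "cls m I (hom_comp s f) = cls m I 0"
    using hom[OF f] by (simp add: cls_eq_iff[OF I])
  ultimately show ?thesis
    using linear_functional_eq_functional[OF I \<phi>] linear_functional_cls_0[OF I \<phi>]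
    by (metis functional_hom_comp)
qed

text \<open>Perfect pairing in a graded Artinian Gorenstein algebra. A multiple \<open>x\<^sup>\<gamma> f \<notin> I\<close> with \<open>\<gamma>\<close> of
  maximal degree represents a nonzero socle element. The socle lies in degree \<open>s\<close>, where the
  injective functional \<open>\<phi>\<close> cannot vanish on it.\<close>

lemma volume_functional_nondegenerate:
  fixes I :: "'k::field mpoly set"
  assumes I: "ideal I (poly_ring m)" and hom: "\<And>f d. f \<in> I \<Longrightarrow> hom_comp d f \<in> I"
    and gor: "artinian_gorenstein m I s"
    and \<phi>: "linear_functional m I s \<phi>" and inj: "inj_on \<phi> (graded_piece m I s)"
    and f: "f \<in> carrier (poly_ring m)"
    and ann: "\<And>\<gamma>. keys \<gamma> \<subseteq> {..<m} \<Longrightarrow>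
      functional (exps m s) (\<lambda>\<alpha>. \<phi> (cls m I (monom \<alpha> 1))) (monom \<gamma> 1 * f) = 0"
  shows "f \<in> I"
proof (rule ccontr)
  assume nf: "f \<notin> I"
  let ?L = "\<lambda>\<alpha>. \<phi> (cls m I (monom \<alpha> 1))"
  obtain N where N: "\<And>\<alpha>. keys \<alpha> \<subseteq> {..<m} \<Longrightarrow> N \<le> exp_deg \<alpha> \<Longrightarrow> monom \<alpha> 1 \<in> I"
    using artinian_imp_high_degree_mem[OF I hom] gor unfolding artinian_gorenstein_def by blast
  \<comment> \<open>Degrees of monomials whose multiple of \<open>f\<close> survives modulo \<open>I\<close>.\<close>
  define P where "P d \<longleftrightarrow> (\<exists>\<gamma>. keys \<gamma> \<subseteq> {..<m} \<and> exp_deg \<gamma> = d \<and> monom \<gamma> 1 * f \<notin> I)" for d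
  have P0: "P 0" unfolding P_def using nf by (intro exI[of _ 0]) (simp add: exp_deg_def)
  have bound: "d \<le> N" if "P d" for d
  proof (rule ccontr)
    assume "\<not> d \<le> N"
    then obtain \<gamma> where \<gamma>: "keys \<gamma> \<subseteq> {..<m}" "N \<le> exp_deg \<gamma>" "monom \<gamma> 1 * f \<notin> I"
      using \<open>P d\<close> unfolding P_def by force
    show False using ideal_mult[OF I N[OF \<gamma>(1,2)] f] \<gamma>(3) by (simp add: mult.commute)
  qed
  define d where "d = (GREATEST d. P d)"
  have Pd: "P d" unfolding d_def using GreatestI_nat[of P 0 N] P0 bound by blast
  have max: "e \<le> d" if "P e" for e
    unfolding d_def using Greatest_le_nat[of P e N] that bound by blast
  obtain \<gamma> where \<gamma>: "keys \<gamma> \<subseteq> {..<m}" "exp_deg \<gamma> = d" "monom \<gamma> 1 * f \<notin> I"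
    using Pd unfolding P_def by blast
  define g where "g = monom \<gamma> 1 * f"
  have gS: "g \<in> carrier (poly_ring m)"
    by (simp add: g_def poly_ring_mult_closed poly_ring_monom \<gamma>(1) f)
  have "var i * g \<in> I" if "i < m" for i
  proof (rule ccontr)
    assume *: "var i * g \<notin> I"
    let ?\<delta> = "Poly_Mapping.single i 1 + \<gamma>"
    have "var i * g = monom ?\<delta> 1 * f"
      by (simp add: g_def var_def mult_single flip: mult.assoc)
    moreover have "keys ?\<delta> \<subseteq> {..<m}" using that \<gamma>(1) by (simp add: keys_exp_add)
    moreover have "exp_deg ?\<delta> = Suc d" by (simp add: exp_deg_add \<gamma>(2)) (simp add: exp_deg_def)
    ultimately have "P (Suc d)" using * unfolding P_def by metis
    then show False using max by fastforce
  qed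
  then have "cls m I g \<in> socle m I"
    unfolding socle_def using gS
    by (auto simp: cls_in_carrier[OF I] cls_mult[OF I] cls_eq_zero[OF I] poly_ring_monom var_def)
  then have "cls m I g \<in> graded_piece m I s" using gor unfolding artinian_gorenstein_def by blast
  then obtain h where h: "h \<in> hom_part m s" "cls m I g = cls m I h"
    unfolding graded_piece_def by blast
  have "functional (exps m s) ?L (g - h) = 0"
    by (rule volume_functional_eq_0[OF I hom \<phi>]) (use h(2) in \<open>simp_all add: cls_eq_iff[OF I]\<close>)
  then have "functional (exps m s) ?L h = 0"
    using ann[OF \<gamma>(1)] by (simp add: functional_minus g_def)
  then have "\<phi> (cls m I h) = \<phi> (cls m I 0)"
    using linear_functional_eq_functional[OF I \<phi> h(1)] linear_functional_cls_0[OF I \<phi>] by simp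
  then have "cls m I h = cls m I 0"
    using inj h(1) hom_part_0[of m s] unfolding graded_piece_def by (auto dest: inj_onD)
  then have "cls m I g = cls m I 0" using h(2) by simp
  then show False using \<gamma>(3) by (simp add: cls_eq_iff[OF I] g_def)
qed

section \<open>Multiplication by a generator of the colon ideal\<close>

lemma exp_deg_eq_0: "exp_deg \<alpha> = 0 \<Longrightarrow> \<alpha> = 0"
  by (rule poly_mapping_eqI) (auto simp: exp_deg_def in_keys_iff)

text \<open>Abstract form of the situation: \<open>I\<close> is the annihilator of \<open>\<Lambda>\<close>, given by its values \<open>L\<close> on
  the monomials of degree \<open>s\<close>, and \<open>J\<close> contains the \<open>p\<close>-th powers of elements of \<open>I\<close> and is
  annihilated by \<open>\<Lambda>'\<close>.\<close>

locale frobenius_duality = frobenius_coordinates p coord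
  for p :: nat and coord :: "'k::field \<Rightarrow> 'k \<Rightarrow> 'k" +
  fixes m s :: nat and I J :: "'k mpoly set" and L :: "(nat \<Rightarrow>\<^sub>0 nat) \<Rightarrow> 'k"
  assumes ideal_I: "ideal I (poly_ring m)" and ideal_J: "ideal J (poly_ring m)"
    and J_subset_I: "J \<subseteq> I" and power_mem_J: "g \<in> I \<Longrightarrow> g ^ p \<in> J"
    and functional_I: "f \<in> I \<Longrightarrow> functional (exps m s) L f = 0"
    and frobenius_functional_J:
      "f \<in> J \<Longrightarrow> frobenius_functional p (top_exp m p) (exps m s) L f = 0"
    and functional_nondegenerate: "\<lbrakk>f \<in> carrier (poly_ring m);
      \<And>\<gamma>. keys \<gamma> \<subseteq> {..<m} \<Longrightarrow> functional (exps m s) L (monom \<gamma> 1 * f) = 0\<rbrakk> \<Longrightarrow> f \<in> I"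
begin

abbreviation \<Lambda> :: "'k mpoly \<Rightarrow> 'k" where
  "\<Lambda> \<equiv> functional (exps m s) L"

abbreviation \<Lambda>' :: "'k mpoly \<Rightarrow> 'k" where
  "\<Lambda>' \<equiv> frobenius_functional p (top_exp m p) (exps m s) L"

text \<open>The socle degree of \<open>S/J\<close>, the only degree in which \<open>\<Lambda>'\<close> can be nonzero.\<close>

definition s' :: nat where
  "s' = p * s + m * (p - 1)"

lemma s_le_s': "s \<le> s'"
proof -
  have "1 * s \<le> p * s" by (rule mult_le_mono1) (use p_pos in simp)
  then have "s \<le> p * s" by simp
  then show ?thesis unfolding s'_def by (rule trans_le_add1)
qed

lemma \<Lambda>'_other_degree: "f \<in> hom_part m d \<Longrightarrow> d \<noteq> s' \<Longrightarrow> \<Lambda>' f = 0"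
  unfolding s'_def by (rule frobenius_functional_other_degree)

text \<open>Here and in \<open>mem_J\<close>, testing against all monomials reduces to testing in complementary degree,
  the functional being zero in every other degree.\<close>

lemma mem_I_of_socle_degree:
  assumes f: "f \<in> hom_part m s" and "\<Lambda> f = 0"
  shows "f \<in> I"
proof (rule functional_nondegenerate[OF hom_part_carrier[OF f]])
  fix \<gamma> :: "nat \<Rightarrow>\<^sub>0 nat" assume \<gamma>: "keys \<gamma> \<subseteq> {..<m}"
  show "\<Lambda> (monom \<gamma> 1 * f) = 0"
  proof (cases "exp_deg \<gamma> = 0")
    case True
    then have "\<gamma> = 0" by (rule exp_deg_eq_0)
    then show ?thesis using assms(2) by simp
  next
    case False
    have "monom \<gamma> 1 * f \<in> hom_part m (exp_deg \<gamma> + s)"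
      by (rule hom_part_mult[OF hom_part_monom f]) (simp add: exps_def \<gamma>)
    then show ?thesis by (rule functional_other_degree) (use False in simp)
  qed
qed

lemma mem_J:
  assumes f: "f \<in> hom_part m d" and "d + e = s'"
    and ann: "\<And>\<delta>. \<delta> \<in> exps m e \<Longrightarrow> \<Lambda>' (monom \<delta> 1 * f) = 0"
  shows "f \<in> J"
proof (rule mem_frobenius_power[OF ideal_J power_mem_J functional_nondegenerate
      hom_part_carrier[OF f]])
  fix \<delta> :: "nat \<Rightarrow>\<^sub>0 nat" assume \<delta>: "keys \<delta> \<subseteq> {..<m}"
  show "\<Lambda>' (monom \<delta> 1 * f) = 0"
  proof (cases "exp_deg \<delta> = e")
    case True
    then show ?thesis using ann \<delta> by (simp add: exps_def)
  next
    case False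
    have "monom \<delta> 1 * f \<in> hom_part m (exp_deg \<delta> + d)"
      by (rule hom_part_mult[OF hom_part_monom f]) (simp add: exps_def \<delta>)
    then show ?thesis
      by (rule \<Lambda>'_other_degree) (use False assms(2) in auto)
  qed
qed

lemma mem_J_of_socle_degree:
  assumes f: "f \<in> hom_part m s'" and "\<Lambda>' f = 0"
  shows "f \<in> J"
proof (rule mem_J[OF f, of 0])
  fix \<delta> assume "\<delta> \<in> exps m 0"
  then have "\<delta> = 0" by (simp add: exps_def exp_deg_eq_0)
  then show "\<Lambda>' (monom \<delta> 1 * f) = 0" using assms(2) by simp
qed simp

text \<open>The vectors \<open>(\<Lambda>'(\<epsilon> x\<^sup>\<alpha>))\<^sub>\<alpha>\<close> form a subspace. A vector \<open>v\<close> orthogonal to it makes \<open>f = \<Sum> v\<^sub>\<alpha> x\<^sup>\<alpha>\<close>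
  orthogonal to everything under \<open>\<Lambda>'\<close>, so \<open>f \<in> J \<subseteq> I\<close> and \<open>\<Lambda>(f) = 0\<close>; thus \<open>v\<close> is orthogonal to \<open>L\<close> too,
  and \<open>double_annihilator\<close> applies.\<close>

lemma representing_element_exists:
  obtains \<epsilon> where "\<epsilon> \<in> hom_part m (s' - s)" "\<And>w. w \<in> hom_part m s \<Longrightarrow> \<Lambda>' (\<epsilon> * w) = \<Lambda> w"
proof -
  let ?W = "(\<lambda>\<epsilon> \<alpha>. \<Lambda>' (\<epsilon> * monom \<alpha> 1)) ` hom_part m (s' - s)"
  have "\<exists>w\<in>?W. \<forall>\<alpha>\<in>exps m s. w \<alpha> = L \<alpha>"
  proof (rule double_annihilator[OF finite_exps])
    show "(\<lambda>_. 0) \<in> ?W"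
      by (rule image_eqI[OF _ hom_part_0]) (simp add: frobenius_functional_0)
    fix v w c assume "v \<in> ?W" "w \<in> ?W"
    then obtain x y where x: "x \<in> hom_part m (s' - s)" "v = (\<lambda>\<alpha>. \<Lambda>' (x * monom \<alpha> 1))"
      and y: "y \<in> hom_part m (s' - s)" "w = (\<lambda>\<alpha>. \<Lambda>' (y * monom \<alpha> 1))" by blast
    show "(\<lambda>\<alpha>. v \<alpha> + c * w \<alpha>) \<in> ?W"
      by (rule image_eqI[of _ _ "x + const c * y"])
        (simp_all add: x y hom_part_add hom_part_const_mult distrib_right mult.assoc
          frobenius_functional_add frobenius_functional_const_mult)
  next
    fix v assume v: "\<And>w. w \<in> ?W \<Longrightarrow> (\<Sum>\<alpha>\<in>exps m s. v \<alpha> * w \<alpha>) = 0"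
    define f where "f = (\<Sum>\<alpha>\<in>exps m s. monom \<alpha> (v \<alpha>))"
    have monom_eq: "monom \<alpha> c = const c * monom \<alpha> 1" for \<alpha> and c :: 'k
      by (simp add: const_def mult_single)
    have f: "f \<in> hom_part m s" unfolding f_def by (rule hom_part_sum) (rule hom_part_monom)
    have "f \<in> J"
    proof (rule mem_J[OF f, of "s' - s"])
      fix \<delta> assume "\<delta> \<in> exps m (s' - s)"
      then have \<delta>: "monom \<delta> 1 \<in> hom_part m (s' - s)" by (rule hom_part_monom)
      have "monom \<delta> 1 * f = (\<Sum>\<alpha>\<in>exps m s. const (v \<alpha>) * (monom \<delta> 1 * monom \<alpha> 1))"
        unfolding f_def sum_distrib_left by (subst monom_eq) (simp add: mult_ac)
      then have "\<Lambda>' (monom \<delta> 1 * f) = (\<Sum>\<alpha>\<in>exps m s. v \<alpha> * \<Lambda>' (monom \<delta> 1 * monom \<alpha> 1))"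
        by (simp only: frobenius_functional_sum frobenius_functional_const_mult)
      also have "\<dots> = 0" by (rule v) (rule imageI[OF \<delta>])
      finally show "\<Lambda>' (monom \<delta> 1 * f) = 0" .
    qed (simp add: s_le_s')
    then have "\<Lambda> f = 0" using J_subset_I functional_I by blast
    moreover have "lookup f \<alpha> = v \<alpha>" if "\<alpha> \<in> exps m s" for \<alpha>
      using that by (simp add: f_def lookup_sum lookup_single when_def finite_exps)
    ultimately show "(\<Sum>\<alpha>\<in>exps m s. v \<alpha> * L \<alpha>) = 0" by (simp add: functional_def)
  qed
  then obtain \<epsilon> where \<epsilon>: "\<epsilon> \<in> hom_part m (s' - s)"
    "\<And>\<alpha>. \<alpha> \<in> exps m s \<Longrightarrow> \<Lambda>' (\<epsilon> * monom \<alpha> 1) = L \<alpha>" by auto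
  show thesis
  proof
    fix w :: "'k mpoly" assume w: "w \<in> hom_part m s"
    have "\<epsilon> * w = \<epsilon> * (\<Sum>\<alpha>\<in>exps m s. monom \<alpha> (lookup w \<alpha>))"
      by (simp flip: hom_part_sum_monomials[OF w])
    also have "\<dots> = (\<Sum>\<alpha>\<in>exps m s. const (lookup w \<alpha>) * (\<epsilon> * monom \<alpha> 1))"
      by (simp add: sum_distrib_left const_def mult_single mult.left_commute[of "monom 0 _"])
    finally show "\<Lambda>' (\<epsilon> * w) = \<Lambda> w"
      by (simp add: frobenius_functional_sum frobenius_functional_const_mult \<epsilon>(2) functional_def)
  qed (rule \<epsilon>(1))
qed

text \<open>The identity \<open>\<Lambda>'(\<epsilon> f) = \<Lambda>(f)\<close> extends from degree \<open>s\<close> to all \<open>f\<close>, as both sides vanish in other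
  degrees. For \<open>h \<in> I\<close> it gives \<open>\<Lambda>'(\<epsilon> h f) = \<Lambda>(h f) = 0\<close> for every \<open>f\<close>, so \<open>\<epsilon> h \<in> J\<close>.\<close>

lemma representing_element_in_colon:
  assumes \<epsilon>: "\<epsilon> \<in> hom_part m (s' - s)" and rep: "\<And>w. w \<in> hom_part m s \<Longrightarrow> \<Lambda>' (\<epsilon> * w) = \<Lambda> w"
  shows "\<epsilon> \<in> colon m J I"
proof -
  have rep': "\<Lambda>' (\<epsilon> * f) = \<Lambda> f" if f: "f \<in> carrier (poly_ring m)" for f
  proof -
    have "\<Lambda>' (\<epsilon> * monom \<alpha> c) = \<Lambda> (monom \<alpha> c)" if "keys \<alpha> \<subseteq> {..<m}" for \<alpha> c
    proof (cases "exp_deg \<alpha> = s")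
      case True
      then show ?thesis using rep that by (simp add: hom_part_monom exps_def)
    next
      case False
      have mon: "monom \<alpha> c \<in> hom_part m (exp_deg \<alpha>)" using that by (simp add: hom_part_monom exps_def)
      have "\<Lambda>' (\<epsilon> * monom \<alpha> c) = 0"
        by (rule \<Lambda>'_other_degree[OF hom_part_mult[OF \<epsilon> mon]]) (use False s_le_s' in auto)
      then show ?thesis using functional_other_degree[OF mon False] by simp
    qed
    then have "(\<Sum>\<alpha>\<in>keys f. \<Lambda>' (\<epsilon> * monom \<alpha> (lookup f \<alpha>))) =
        (\<Sum>\<alpha>\<in>keys f. \<Lambda> (monom \<alpha> (lookup f \<alpha>)))"
      using f by (intro sum.cong) (auto simp: in_poly_ring_iff)
    then show ?thesis
      by (simp only: frobenius_functional_sum[symmetric] functional_sum[symmetric]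
          sum_distrib_left[symmetric] poly_mapping_sum_monomials)
  qed
  have "\<epsilon> * h \<in> J" if h: "h \<in> I" for h
  proof (rule mem_frobenius_power[OF ideal_J power_mem_J functional_nondegenerate])
    show "\<epsilon> * h \<in> carrier (poly_ring m)"
      by (rule poly_ring_mult_closed[OF hom_part_carrier[OF \<epsilon>] ideal_subset[OF ideal_I h]])
    fix \<delta> :: "nat \<Rightarrow>\<^sub>0 nat" assume "keys \<delta> \<subseteq> {..<m}"
    then have "monom \<delta> 1 * h \<in> I" by (intro ideal_mult[OF ideal_I h] poly_ring_monom)
    then have "\<Lambda>' (\<epsilon> * (monom \<delta> 1 * h)) = 0"
      using rep' ideal_subset[OF ideal_I] functional_I by simp
    then show "\<Lambda>' (monom \<delta> 1 * (\<epsilon> * h)) = 0" by (simp add: mult.left_commute)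
  qed
  then show ?thesis using hom_part_carrier[OF \<epsilon>] by (simp add: colon_def)
qed

text \<open>Modulo \<open>I\<close> every \<open>w\<close> of degree \<open>s\<close> is \<open>\<Lambda>(w) \<nu>\<close>, and \<open>\<epsilon>\<close> carries \<open>I\<close> into \<open>J\<close>, where \<open>\<Lambda>'\<close>
  vanishes. So the single normalization at \<open>\<nu>\<close> determines \<open>\<epsilon>\<close> as a functional.\<close>

lemma functional_from_colon:
  assumes \<epsilon>: "\<epsilon> \<in> colon m J I"
    and \<nu>: "\<nu> \<in> hom_part m s" "\<Lambda> \<nu> = 1" "\<Lambda>' (\<epsilon> * \<nu>) = 1" and w: "w \<in> hom_part m s"
  shows "\<Lambda>' (\<epsilon> * w) = \<Lambda> w"
proof -
  let ?r = "w - const (\<Lambda> w) * \<nu>"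
  have "?r \<in> I"
  proof (rule mem_I_of_socle_degree)
    show "?r \<in> hom_part m s" by (intro hom_part_minus hom_part_const_mult w \<nu>(1))
    show "\<Lambda> ?r = 0" by (simp add: functional_minus functional_const_mult \<nu>(2))
  qed
  then have "\<Lambda>' (\<epsilon> * ?r) = 0" using \<epsilon> frobenius_functional_J by (simp add: colon_def)
  moreover have "\<epsilon> * ?r = \<epsilon> * w - const (\<Lambda> w) * (\<epsilon> * \<nu>)"
    by (simp add: right_diff_distrib mult.left_commute)
  ultimately show ?thesis
    by (simp add: frobenius_functional_minus frobenius_functional_const_mult \<nu>(3))
qed

lemma representing_element_unique:
  assumes \<epsilon>: "\<epsilon>1 \<in> hom_part m (s' - s)" "\<epsilon>2 \<in> hom_part m (s' - s)"
    and eq: "\<And>w. w \<in> hom_part m s \<Longrightarrow> \<Lambda>' (\<epsilon>1 * w) = \<Lambda>' (\<epsilon>2 * w)"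
  shows "\<epsilon>1 - \<epsilon>2 \<in> J"
proof (rule mem_J[OF hom_part_minus[OF \<epsilon>], of s])
  fix \<delta> assume "\<delta> \<in> exps m s"
  then have "\<Lambda>' (\<epsilon>1 * monom \<delta> 1) = \<Lambda>' (\<epsilon>2 * monom \<delta> 1)" by (intro eq hom_part_monom)
  then show "\<Lambda>' (monom \<delta> 1 * (\<epsilon>1 - \<epsilon>2)) = 0"
    by (simp add: left_diff_distrib frobenius_functional_minus mult.commute[of "monom \<delta> 1"])
qed (simp add: s_le_s')

end

context frobenius_coordinates
begin

text \<open>The \<open>p\<close>-th power map is additive, so the elements whose \<open>p\<close>-th power lies in a given ideal form
  an ideal.\<close>

lemma power_mem_genideal:
  fixes G :: "'k mpoly set"
  assumes G: "G \<subseteq> carrier (poly_ring m)" and f: "f \<in> genideal (poly_ring m) G"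
  shows "f ^ p \<in> genideal (poly_ring m) ((\<lambda>g. g ^ p) ` G)"
proof -
  interpret cring "poly_ring m :: 'k mpoly ring" by (rule cring_poly_ring)
  let ?J = "genideal (poly_ring m) ((\<lambda>g. g ^ p) ` G)"
  have G': "(\<lambda>g. g ^ p) ` G \<subseteq> carrier (poly_ring m)" using G poly_ring_power by blast
  have J: "ideal ?J (poly_ring m)" by (rule genideal_ideal[OF G'])
  let ?K = "{f \<in> carrier (poly_ring m). f ^ p \<in> ?J}"
  have "0 ^ p \<in> ?J" using ideal_0[OF J] p_pos by (simp add: power_0_left)
  then have "ideal ?K (poly_ring m)"
    by (intro ideal_poly_ringI)
      (auto simp: poly_ring_0 poly_ring_add_closed poly_add_power_p
        ideal_add[OF J] poly_ring_mult_closed power_mult_distrib ideal_mult[OF J] poly_ring_power)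
  moreover have "G \<subseteq> ?K" using G genideal_self[OF G'] by blast
  ultimately have "genideal (poly_ring m) G \<subseteq> ?K" by (rule genideal_minimal)
  then show ?thesis using f by blast
qed

lemma frobenius_functional_genideal:
  fixes G :: "'k mpoly set"
  assumes I: "ideal I (poly_ring m)" "\<And>f. f \<in> I \<Longrightarrow> functional A L f = 0" and G: "G \<subseteq> I"
    and f: "f \<in> genideal (poly_ring m) ((\<lambda>g. g ^ p) ` G)"
  shows "frobenius_functional p (top_exp m p) A L f = 0"
proof -
  interpret cring "poly_ring m :: 'k mpoly ring" by (rule cring_poly_ring)
  let ?\<Lambda> = "frobenius_functional p (top_exp m p) A L"
  let ?K = "{f \<in> carrier (poly_ring m). \<forall>h\<in>carrier (poly_ring m). ?\<Lambda> (f * h) = 0}"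
  have "ideal ?K (poly_ring m)"
  proof (rule ideal_poly_ringI)
    fix f h :: "'k mpoly" assume f: "f \<in> ?K" and h: "h \<in> carrier (poly_ring m)"
    have "?\<Lambda> (f * (h * k)) = 0" if "k \<in> carrier (poly_ring m)" for k
      using f h that poly_ring_mult_closed by blast
    then show "h * f \<in> ?K" using f h by (simp add: poly_ring_mult_closed mult_ac)
  qed (auto simp: poly_ring_0 frobenius_functional_0 poly_ring_add_closed distrib_right
      frobenius_functional_add)
  moreover have "(\<lambda>g. g ^ p) ` G \<subseteq> ?K"
    using G frobenius_functional_power_mult_eq_0[OF I] ideal_subset[OF I(1)] poly_ring_power by blast
  ultimately have "f \<in> ?K" using genideal_minimal f by blast
  moreover have "1 \<in> carrier (poly_ring m)" by (simp add: in_poly_ring_iff)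
  ultimately have "?\<Lambda> (f * 1) = 0" by blast
  then show ?thesis by simp
qed

end

lemma kron_pairing_monom: "kron_pairing (monom \<alpha> 1) f = lookup f \<alpha>"
  by (simp add: kron_pairing_def)

text \<open>The sum in the volume formula is the value of \<open>\<Lambda>'\<close> at the polynomial \<open>f\<close>.\<close>

lemma frobenius_functional_eq_sum_monomials:
  "(\<Sum>u\<in>monomials m s.
      kron_pairing ((\<Prod>i<m. var i ^ (p - 1)) * u ^ p) f * \<phi> u ^ p) =
    frobenius_functional p (top_exp m p) (exps m s) (\<lambda>\<alpha>. \<phi> (monom \<alpha> 1)) (f :: 'k::field mpoly)"
proof -
  have img: "(monomials m s :: 'k mpoly set) = (\<lambda>\<alpha>. monom \<alpha> 1) ` exps m s"
    by (auto simp: monomials_def exps_def)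
  have inj: "inj_on (\<lambda>\<alpha>. monom \<alpha> (1::'k)) (exps m s)"
  proof (rule inj_onI)
    fix \<alpha> \<beta> :: "nat \<Rightarrow>\<^sub>0 nat" assume "monom \<alpha> (1::'k) = monom \<beta> 1"
    from arg_cong[OF this, of keys] show "\<alpha> = \<beta>" by simp
  qed
  show ?thesis
    unfolding img sum.reindex[OF inj] frobenius_functional_def
    by (simp only: prod_var_power)
      (simp add: single_power mult_single kron_pairing_monom add.commute[of "top_exp m p"])
qed

section \<open>The volume formula\<close>

theorem theorem1p1:
  fixes m n s p s_hat :: nat
    and g :: "nat \<Rightarrow> 'k::field mpoly"
    and I I_p :: "'k mpoly set"
    and vol vol_hat :: "'k mpoly set \<Rightarrow> 'k"
    and \<nu> :: "'k mpoly set"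
  assumes char: "CHAR('k) = p" "p > 0"
    and gens: "minimal_hom_gens m n g I"
    and gorenstein: "artinian_gorenstein m I s"
    and vol_linear: "linear_functional m I s vol"
    and vol_bij: "bij_betw vol (graded_piece m I s) UNIV"
    and nu: "\<nu> \<in> graded_piece m I s" "vol \<nu> = 1"
    and I_p: "I_p = genideal (poly_ring m) ((\<lambda>i. g i ^ p) ` {..<n})"
    and s_hat: "s_hat = p * s + m * (p - 1)"
    and vol_hat_linear: "linear_functional m I_p s_hat vol_hat"
    and vol_hat_normalized:
      "vol_hat (cls m I_p (\<Prod>i<m. var i ^ (p - 1))
        \<otimes>\<^bsub>poly_ring m Quot I_p\<^esub> frob_cls m I_p p \<nu>) = 1"
  shows "(\<exists>!\<epsilon>. \<epsilon> \<in> colon_quot_piece m I_p I (s_hat - s) \<and> vol_hat (lift_mult m I_p \<epsilon> \<nu>) = 1) \<and>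
    (\<forall>\<epsilon> \<in> colon_quot_piece m I_p I (s_hat - s). vol_hat (lift_mult m I_p \<epsilon> \<nu>) = 1 \<longrightarrow>
      (\<forall>\<epsilon>' \<in> \<epsilon> \<inter> hom_part m (s_hat - s). \<forall>w \<in> hom_part m s.
        vol (cls m I w) =
          (\<Sum>u\<in>monomials m s.
            kron_pairing ((\<Prod>i<m. var i ^ (p - 1)) * u ^ p) (\<epsilon>' * w) * vol (cls m I u) ^ p)))"
proof -
  obtain coord :: "'k \<Rightarrow> 'k \<Rightarrow> 'k" where "frobenius_coordinates p coord"
    using frobenius_coordinates_exist[OF char] by blast
  then interpret frobenius_coordinates p coord .
  interpret S: cring "poly_ring m :: 'k mpoly ring" by (rule cring_poly_ring)
  let ?G = "g ` {..<n}"
  have gens_hom: "\<exists>d. f \<in> hom_part m d" if "f \<in> ?G" for f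
    using gens that by (auto simp: minimal_hom_gens_def)
  have I_def: "I = genideal (poly_ring m) ?G" using gens by (simp add: minimal_hom_gens_def)
  have J_def: "I_p = genideal (poly_ring m) ((\<lambda>f. f ^ p) ` ?G)" by (simp add: I_p image_image)
  have G: "?G \<subseteq> carrier (poly_ring m)" using gens_hom hom_part_carrier by blast
  have G': "(\<lambda>f. f ^ p) ` ?G \<subseteq> carrier (poly_ring m)" using G poly_ring_power by blast
  have I: "ideal I (poly_ring m)" unfolding I_def by (rule S.genideal_ideal[OF G])
  have J: "ideal I_p (poly_ring m)" unfolding J_def by (rule S.genideal_ideal[OF G'])
  have hom: "hom_comp d f \<in> I" if "f \<in> I" for f d
    using genideal_homogeneous[OF gens_hom] that unfolding I_def by blast
  have G_I: "?G \<subseteq> I" unfolding I_def by (rule S.genideal_self[OF G])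
  have inj: "inj_on vol (graded_piece m I s)" using vol_bij by (rule bij_betw_imp_inj_on)
  define L where "L = (\<lambda>\<alpha>. vol (cls m I (monom \<alpha> 1)))"
  have kill: "functional (exps m s) L f = 0" if "f \<in> I" for f
    unfolding L_def by (rule volume_functional_eq_0[OF I hom vol_linear that])
  interpret frobenius_duality p coord m s I I_p L
  proof (rule frobenius_duality.intro[OF frobenius_coordinates_axioms frobenius_duality_axioms.intro])
    show "I_p \<subseteq> I"
      unfolding J_def
    proof (rule S.genideal_minimal[OF I], rule image_subsetI)
      fix f assume "f \<in> ?G"
      then have "f ^ (p - 1) * f \<in> I" using G_I G by (intro ideal_mult[OF I] poly_ring_power) auto
      then show "f ^ p \<in> I" by (simp only: power_minus_mult[OF char(2)])
    qed
    show "f ^ p \<in> I_p" if "f \<in> I" for f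
      using power_mem_genideal[OF G] that unfolding I_def J_def by blast
    show "frobenius_functional p (top_exp m p) (exps m s) L f = 0" if "f \<in> I_p" for f
      using frobenius_functional_genideal[OF I kill G_I] that unfolding J_def by blast
    show "f \<in> I" if "f \<in> carrier (poly_ring m)"
      "\<And>\<gamma>. keys \<gamma> \<subseteq> {..<m} \<Longrightarrow> functional (exps m s) L (monom \<gamma> 1 * f) = 0" for f
      using volume_functional_nondegenerate[OF I hom gorenstein vol_linear inj that(1)] that(2)
      unfolding L_def by blast
  qed (fact I J kill)+
  have s': "s' = s_hat" by (simp add: s'_def s_hat)
  have vol_eq: "vol (cls m I f) = \<Lambda> f" if "f \<in> hom_part m s" for f
    using linear_functional_eq_functional[OF I vol_linear that] by (simp add: L_def)
  obtain x where x: "x \<in> hom_part m s" "\<nu> = cls m I x" using nu(1) by (auto simp: graded_piece_def)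
  have \<Lambda>_x: "\<Lambda> x = 1" using vol_eq[OF x(1)] nu(2) x(2) by simp
  have \<nu>_iff: "h \<in> \<nu> \<longleftrightarrow> h - x \<in> I" for h by (simp add: x(2) mem_cls_iff)
  have x_\<nu>: "x \<in> \<nu>" by (simp add: \<nu>_iff ideal_0[OF I])
  have \<nu>_carrier: "h \<in> carrier (poly_ring m)" if "h \<in> \<nu>" for h
    using poly_ring_add_closed[OF ideal_subset[OF I] hom_part_carrier[OF x(1)], of "h - x"] that
    by (simp add: \<nu>_iff)
  let ?u = "monom (top_exp m p) 1 * x ^ p"
  have u: "?u \<in> hom_part m s_hat"
  proof -
    have "monom (top_exp m p) 1 \<in> hom_part m (m * (p - 1))"
      by (rule hom_part_monom) (simp add: exps_def keys_top_exp exp_deg_top_exp)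
    from hom_part_mult[OF this hom_part_power[OF x(1)]] show ?thesis by (simp add: s_hat add.commute)
  qed
  have \<Lambda>'_u: "\<Lambda>' ?u = 1" by (simp add: frobenius_functional_top_times_power \<Lambda>_x)
  have "frob_cls m I_p p \<nu> = cls m I_p (x ^ p)"
  proof -
    have "cls m I_p (h ^ p) = cls m I_p (x ^ p)" if "h \<in> \<nu>" for h
    proof -
      have "h ^ p = (h - x) ^ p + x ^ p" using poly_add_power_p[of "h - x" x] by simp
      then have "h ^ p - x ^ p \<in> I_p" using power_mem_J that by (simp add: \<nu>_iff)
      then show ?thesis by (simp add: cls_eq_iff[OF J])
    qed
    then show ?thesis unfolding frob_cls_def using x_\<nu> by blast
  qed
  then have "vol_hat (cls m I_p (monom (top_exp m p) 1) \<otimes>\<^bsub>poly_ring m Quot I_p\<^esub> cls m I_p (x ^ p)) = 1"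
    using vol_hat_normalized by (simp only: prod_var_power)
  then have vol_hat_u: "vol_hat (cls m I_p ?u) = 1"
    by (simp add: cls_mult[OF J] poly_ring_monom keys_top_exp poly_ring_power hom_part_carrier[OF x(1)])
  \<comment> \<open>\<open>S/I_p\<close> is one-dimensional in degree \<open>s_hat\<close>: there, \<open>I_p\<close> is the kernel of \<open>\<Lambda>'\<close>. So the
    normalization pins \<open>vol_hat\<close> down.\<close>
  have vol_hat_eq: "vol_hat (cls m I_p f) = \<Lambda>' f" if f: "f \<in> hom_part m s_hat" for f
  proof -
    have "f - const (\<Lambda>' f) * ?u \<in> I_p"
    proof (rule mem_J_of_socle_degree)
      show "f - const (\<Lambda>' f) * ?u \<in> hom_part m s'"
        unfolding s' by (intro hom_part_minus hom_part_const_mult f u)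
      show "\<Lambda>' (f - const (\<Lambda>' f) * ?u) = 0"
        by (simp only: frobenius_functional_minus frobenius_functional_const_mult \<Lambda>'_u) simp
    qed
    then have "cls m I_p f = cls m I_p (const (\<Lambda>' f) * ?u)" by (simp only: cls_eq_iff[OF J])
    then show ?thesis
      by (simp only: linear_functional_cls_const_mult[OF J vol_hat_linear u] vol_hat_u) simp
  qed
  have J_colon: "f \<in> colon m I_p I" if "f \<in> I_p" for f
    using that ideal_mult[OF J that] ideal_subset[OF I] ideal_subset[OF J]
    by (simp add: colon_def mult.commute[of f])
  have colon_add: "f + h \<in> colon m I_p I" if "f \<in> colon m I_p I" "h \<in> colon m I_p I" for f h
    using that by (simp add: colon_def poly_ring_add_closed distrib_right ideal_add[OF J])
  \<comment> \<open>The product does not depend on the lifts because \<open>e\<close> carries \<open>I\<close>, the ambiguity of \<open>\<nu>\<close>,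
    into \<open>I_p\<close>.\<close>
  have lift: "lift_mult m I_p (cls m I_p e) \<nu> = cls m I_p (e * x)"
    if e: "e \<in> colon m I_p I" for e
  proof (rule lift_mult_eq_cls)
    fix f h assume f: "f \<in> cls m I_p e" and h: "h \<in> \<nu>"
    have "(f - e) * h \<in> I_p"
      using ideal_mult[OF J _ \<nu>_carrier[OF h], of "f - e"] f by (simp add: mem_cls_iff mult.commute)
    moreover have "e * (h - x) \<in> I_p" using e h by (simp add: colon_def \<nu>_iff)
    ultimately have "(f - e) * h + e * (h - x) \<in> I_p" by (rule ideal_add[OF J])
    then show "cls m I_p (f * h) = cls m I_p (e * x)"
      by (simp add: cls_eq_iff[OF J] algebra_simps)
  next
    show "cls m I_p e \<noteq> {}" using ideal_0[OF J] mem_cls_iff[of e m I_p e] by auto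
  qed (use x_\<nu> in blast)
  have lift_vol: "vol_hat (lift_mult m I_p (cls m I_p e) \<nu>) = \<Lambda>' (e * x)"
    if "e \<in> colon m I_p I" "e \<in> hom_part m (s_hat - s)" for e
    using hom_part_mult[OF that(2) x(1)] s_le_s' by (simp add: lift that(1) vol_hat_eq s')
  have good: "\<epsilon>' \<in> colon m I_p I \<and> \<epsilon> = cls m I_p \<epsilon>'"
    if "\<epsilon> \<in> colon_quot_piece m I_p I (s_hat - s)" "\<epsilon>' \<in> \<epsilon>" for \<epsilon> \<epsilon>'
  proof -
    obtain e where e: "e \<in> colon m I_p I" "\<epsilon> = cls m I_p e"
      using \<open>\<epsilon> \<in> _\<close> by (auto simp: colon_quot_piece_def)
    have d: "\<epsilon>' - e \<in> I_p" using \<open>\<epsilon>' \<in> \<epsilon>\<close> by (simp add: e(2) mem_cls_iff)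
    have "e + (\<epsilon>' - e) \<in> colon m I_p I" by (rule colon_add[OF e(1) J_colon[OF d]])
    moreover have "cls m I_p \<epsilon>' = cls m I_p e" using d by (simp add: cls_eq_iff[OF J])
    ultimately show ?thesis using e(2) by simp
  qed
  have represents: "\<Lambda>' (\<epsilon>' * w) = \<Lambda> w"
    if "\<epsilon> \<in> colon_quot_piece m I_p I (s_hat - s)" "vol_hat (lift_mult m I_p \<epsilon> \<nu>) = 1"
      "\<epsilon>' \<in> \<epsilon>" "\<epsilon>' \<in> hom_part m (s_hat - s)" "w \<in> hom_part m s" for \<epsilon> \<epsilon>' w
    using good[OF that(1,3)] lift_vol[of \<epsilon>'] that
    by (intro functional_from_colon[OF _ x(1) \<Lambda>_x]) auto
  have homogeneous_lift: "\<exists>\<epsilon>'\<in>\<epsilon>. \<epsilon>' \<in> hom_part m (s_hat - s)"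
    if "\<epsilon> \<in> colon_quot_piece m I_p I (s_hat - s)" for \<epsilon>
  proof -
    obtain e where "e \<in> hom_part m (s_hat - s)" "\<epsilon> = cls m I_p e"
      using \<open>\<epsilon> \<in> _\<close> by (auto simp: colon_quot_piece_def graded_piece_def)
    then show ?thesis using ideal_0[OF J] mem_cls_iff[of e m I_p e] by auto
  qed
  have "\<exists>!\<epsilon>. \<epsilon> \<in> colon_quot_piece m I_p I (s_hat - s) \<and> vol_hat (lift_mult m I_p \<epsilon> \<nu>) = 1"
  proof (rule ex_ex1I)
    obtain e where e: "e \<in> hom_part m (s_hat - s)" "\<And>w. w \<in> hom_part m s \<Longrightarrow> \<Lambda>' (e * w) = \<Lambda> w"
      using representing_element_exists unfolding s' by blast
    have "e \<in> colon m I_p I" by (rule representing_element_in_colon) (simp_all add: e s')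
    then show "\<exists>\<epsilon>. \<epsilon> \<in> colon_quot_piece m I_p I (s_hat - s) \<and> vol_hat (lift_mult m I_p \<epsilon> \<nu>) = 1"
      using e x(1) \<Lambda>_x
      by (intro exI[of _ "cls m I_p e"]) (auto simp: lift_vol colon_quot_piece_def graded_piece_def)
  next
    fix \<epsilon>1 \<epsilon>2
    assume 1: "\<epsilon>1 \<in> colon_quot_piece m I_p I (s_hat - s) \<and> vol_hat (lift_mult m I_p \<epsilon>1 \<nu>) = 1"
      and 2: "\<epsilon>2 \<in> colon_quot_piece m I_p I (s_hat - s) \<and> vol_hat (lift_mult m I_p \<epsilon>2 \<nu>) = 1"
    obtain e1 e2 where e1: "e1 \<in> \<epsilon>1" "e1 \<in> hom_part m (s_hat - s)"
      and e2: "e2 \<in> \<epsilon>2" "e2 \<in> hom_part m (s_hat - s)"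
      using homogeneous_lift 1 2 by meson
    have "e1 - e2 \<in> I_p"
    proof (rule representing_element_unique)
      fix w :: "'k mpoly" assume w: "w \<in> hom_part m s"
      show "\<Lambda>' (e1 * w) = \<Lambda>' (e2 * w)"
        using represents[OF _ _ e1 w] represents[OF _ _ e2 w] 1 2 by simp
    qed (simp_all add: s' e1 e2)
    then show "\<epsilon>1 = \<epsilon>2"
      using good[of \<epsilon>1 e1] good[of \<epsilon>2 e2] 1 2 e1(1) e2(1) by (simp add: cls_eq_iff[OF J])
  qed
  moreover have "vol (cls m I w) = (\<Sum>u\<in>monomials m s.
      kron_pairing ((\<Prod>i<m. var i ^ (p - 1)) * u ^ p) (\<epsilon>' * w) * vol (cls m I u) ^ p)"
    if "\<epsilon> \<in> colon_quot_piece m I_p I (s_hat - s)" "vol_hat (lift_mult m I_p \<epsilon> \<nu>) = 1"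
      "\<epsilon>' \<in> \<epsilon> \<inter> hom_part m (s_hat - s)" "w \<in> hom_part m s" for \<epsilon> \<epsilon>' w
  proof -
    have "vol (cls m I w) = \<Lambda>' (\<epsilon>' * w)" using represents[of \<epsilon> \<epsilon>' w] that vol_eq by simp
    then show ?thesis
      unfolding frobenius_functional_eq_sum_monomials[where \<phi> = "\<lambda>u. vol (cls m I u)"]
      by (simp add: L_def)
  qed
  ultimately show ?thesis by blast
qed

end
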